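(* Let $(V,\|\cdot\|)$ be a real Banach space whose dual $V^*$ has the Radon–Nikodým property, let $\Psi:V\to[0,+\infty)$ be a convex $C^1$ functional whose convex conjugate $\Psi^*$ is also $C^1$ on $V^*$, and let $\Phi:V\to(-\infty,+\infty]$ be proper, lower semicontinuous and $\lambda$-convex for $\Psi$ for some $\lambda\in\mathbb R$. Assume that there exist $\alpha>1$ and $C_\alpha>0$ such that $\|y-x\|^\alpha\le C_\alpha D_\Psi(y,x)$ for all $x,y\in V$, and that there exists a continuous function $g:(0,+\infty)\to(0,+\infty)$ with $g(0):=\lim_{r\to0}g(r)=+\infty$ and $g(\|\varphi\|+\|\psi\|)\,\|\varphi-\psi\|^2\le D_{\Psi^*}(\varphi,\psi)$ for all $\varphi,\psi\in V^*$ (with $\infty\cdot0:=0$). Let $t\in[0,+\infty)\mapsto x_t\in V$ be a map. Then the following are equivalent: (i) $(x_t)$ is a $\Psi$-mirror flow for $\Phi$; (ii) $(x_t)$ is a $\lambda$-EVI solution for the pair $(D_\Psi,\Phi)$ and the map $t\in[0,+\infty)\mapsto\nabla\Psi(x_t)$ is locally absolutely continuous. In particular, if $(x_t)$ is a $\Psi$-mirror flow for $\Phi$, then $t\in[0,+\infty)\mapsto\Phi(x_t)$ is non-increasing.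
   Context: $\nabla\Psi:V\to V^*$ and $\nabla\Psi^*$ are the Fréchet derivatives; $\Psi^*(\varphi)=\sup_{x\in V}(\langle\varphi,x\rangle-\Psi(x))$. Bregman divergences: $D_\Psi(x,y):=\Psi(x)-\Psi(y)-\langle\nabla\Psi(y),x-y\rangle$ for $x,y\in V$, and $D_{\Psi^*}(\varphi,\psi):=\Psi^*(\varphi)-\Psi^*(\psi)-\langle\nabla\Psi^*(\psi),\varphi-\psi\rangle$ for $\varphi,\psi\in V^*$. $\Phi$ is $\lambda$-convex for $\Psi$ if $\Phi-\lambda\Psi$ is convex. $\mathsf D(\Phi):=\{\Phi<+\infty\}$; proper means $\mathsf D(\Phi)\ne\emptyset$. The Fréchet subdifferential at $x\in\mathsf D(\Phi)$ is $\partial_F\Phi(x):=\{\xi\in V^*:\liminf_{y\to x}\frac{\Phi(y)-\Phi(x)-\langle\xi,y-x\rangle}{\|y-x\|}\ge0\}$ (empty if $x\notin\mathsf D(\Phi)$). Locally absolutely continuous: there is $A\in L^1_{\rm loc}([0,+\infty))$ with $\|\nabla\Psi(x_t)-\nabla\Psi(x_s)\|\le\int_s^tA(r)\,dr$ for $0\le s\le t$. A $\Psi$-mirror flow for $\Phi$ is a map $t\in[0,+\infty)\mapsto x_t\in V$ such that $t\mapsto\nabla\Psi(x_t)\in V^*$ is locally absolutely continuous and $\frac{d}{dt}\nabla\Psi(x_t)\in-\partial_F\Phi(x_t)$ for Lebesgue-a.e. $t>0$. A $\lambda$-EVI solution for $(D_\Psi,\Phi)$ is a map $t\in[0,+\infty)\mapsto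 x_t\in V$ such that $$e^{\lambda(t-s)}D_\Psi(x,x_t)-D_\Psi(x,x_s)\le E_\lambda(t-s)\,(\Phi(x)-\Phi(x_t))\quad\text{for all }0\le s\le t,\ x\in\mathsf D(\Phi),$$ where $E_\lambda(t):=\int_0^te^{\lambda r}\,dr$ (for $t=s$ the right-hand side is read as $0$). *)

theory Defs
  imports "HOL-Analysis.Analysis"
begin

text \<open>The dual of a real Banach space \<open>'v\<close> is \<open>'v \<Rightarrow>\<^sub>L real\<close> with the operator norm.\<close>

subsection \<open>The Radon--Nikodym property\<close>

text \<open>
  The library restricts \<^const>\<open>has_bochner_integral\<close> to second countable target spaces, which dual
  spaces need not be.  The following is its defining clause without that restriction.  The
  \<open>L\<^sup>1\<close> approximation by simple functions forces \<open>f\<close> to be almost everywhere separably valued.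
\<close>

definition has_Bochner_integral ::
    "'a measure \<Rightarrow> ('a \<Rightarrow> 'b::real_normed_vector) \<Rightarrow> 'b \<Rightarrow> bool" where
  "has_Bochner_integral M f I \<longleftrightarrow>
     f \<in> borel_measurable M \<and>
     (\<exists>s. (\<forall>i. Bochner_Integration.simple_bochner_integrable M (s i)) \<and>
          (\<lambda>i::nat. \<integral>\<^sup>+\<omega>. ennreal (norm (f \<omega> - s i \<omega>)) \<partial>M) \<longlonglongrightarrow> 0 \<and>
          (\<lambda>i. Bochner_Integration.simple_bochner_integral M (s i)) \<longlonglongrightarrow> I)"

definition vector_measure :: "'a measure \<Rightarrow> ('a set \<Rightarrow> 'b::real_normed_vector) \<Rightarrow> bool" where
  "vector_measure M G \<longleftrightarrow>
     (\<forall>A::nat \<Rightarrow> 'a set. range A \<subseteq> sets M \<longrightarrow> disjoint_family A \<longrightarrow> (\<lambda>i. G (A i)) sums G (\<Union>i. A i))"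

definition bounded_variation_measure ::
    "'a measure \<Rightarrow> ('a set \<Rightarrow> 'b::real_normed_vector) \<Rightarrow> bool" where
  "bounded_variation_measure M G \<longleftrightarrow>
     (\<exists>K. \<forall>P. finite P \<longrightarrow> P \<subseteq> sets M \<longrightarrow> disjoint P \<longrightarrow> \<Union>P = space M \<longrightarrow> (\<Sum>E\<in>P. norm (G E)) \<le> K)"

definition abs_cont_measure ::
    "'a measure \<Rightarrow> ('a set \<Rightarrow> 'b::real_normed_vector) \<Rightarrow> bool" where
  "abs_cont_measure M G \<longleftrightarrow> (\<forall>E\<in>null_sets M. G E = 0)"

definition radon_nikodym_wrt :: "'a measure \<Rightarrow> 'b::banach itself \<Rightarrow> bool" where
  "radon_nikodym_wrt M _ \<longleftrightarrow>
     (\<forall>G :: 'a set \<Rightarrow> 'b.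
        vector_measure M G \<longrightarrow> bounded_variation_measure M G \<longrightarrow> abs_cont_measure M G \<longrightarrow>
        (\<exists>g. \<forall>E\<in>sets M. has_Bochner_integral M (\<lambda>\<omega>. indicator E \<omega> *\<^sub>R g \<omega>) (G E)))"

text \<open>
  HOL cannot quantify over the types carrying the measure spaces, so the measure spaces range over
  all finite ones (with arbitrary carrier sets and sigma-algebras) on the type \<^typ>\<open>real\<close>.  This is
  no restriction: the property already holds for all finite measure spaces when it holds for
  Lebesgue measure on \<open>[0,1]\<close>.
\<close>

definition radon_nikodym_property :: "'b::banach itself \<Rightarrow> bool" where
  "radon_nikodym_property T \<longleftrightarrow> (\<forall>M :: real measure. finite_measure M \<longrightarrow> radon_nikodym_wrt M T)"


subsection \<open>Convex analysis\<close>

definition grad :: "('v::real_normed_vector \<Rightarrow> real) \<Rightarrow> 'v \<Rightarrow> 'v \<Rightarrow>\<^sub>L real" where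
  "grad f x = Blinfun (frechet_derivative f (at x))"

definition C1_functional :: "('v::real_normed_vector \<Rightarrow> real) \<Rightarrow> bool" where
  "C1_functional f \<longleftrightarrow> (\<forall>x. f differentiable (at x)) \<and> continuous_on UNIV (grad f)"

definition fenchel_conj :: "('v::real_normed_vector \<Rightarrow> real) \<Rightarrow> ('v \<Rightarrow>\<^sub>L real) \<Rightarrow> ereal" where
  "fenchel_conj f \<phi> = (SUP x. ereal (blinfun_apply \<phi> x - f x))"

text \<open>Meaningful where the conjugate is finite.\<close>

definition conjugate_real :: "('v::real_normed_vector \<Rightarrow> real) \<Rightarrow> ('v \<Rightarrow>\<^sub>L real) \<Rightarrow> real" where
  "conjugate_real f \<phi> = real_of_ereal (fenchel_conj f \<phi>)"

definition bregman :: "('v::real_normed_vector \<Rightarrow> real) \<Rightarrow> 'v \<Rightarrow> 'v \<Rightarrow> real" where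
  "bregman f x y = f x - f y - blinfun_apply (grad f y) (x - y)"

definition eff_dom :: "('v \<Rightarrow> ereal) \<Rightarrow> 'v set" where
  "eff_dom f = {x. f x < \<infinity>}"

definition lsc :: "('v::topological_space \<Rightarrow> ereal) \<Rightarrow> bool" where
  "lsc f \<longleftrightarrow> (\<forall>x. f x \<le> Liminf (at x) f)"

definition convex_ereal :: "('v::real_vector \<Rightarrow> ereal) \<Rightarrow> bool" where
  "convex_ereal f \<longleftrightarrow>
     (\<forall>x y. \<forall>t::real. 0 < t \<longrightarrow> t < 1 \<longrightarrow>
        f ((1 - t) *\<^sub>R x + t *\<^sub>R y) \<le> ereal (1 - t) * f x + ereal t * f y)"

definition convex_for :: "real \<Rightarrow> ('v::real_vector \<Rightarrow> real) \<Rightarrow> ('v \<Rightarrow> ereal) \<Rightarrow> bool" where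
  "convex_for lam \<Psi> \<Phi> \<longleftrightarrow> convex_ereal (\<lambda>x. \<Phi> x - ereal (lam * \<Psi> x))"

definition frechet_subdiff :: "('v::real_normed_vector \<Rightarrow> ereal) \<Rightarrow> 'v \<Rightarrow> ('v \<Rightarrow>\<^sub>L real) set" where
  "frechet_subdiff \<Phi> x =
     {\<xi>. x \<in> eff_dom \<Phi> \<and>
        0 \<le> Liminf (at x)
              (\<lambda>y. (\<Phi> y - \<Phi> x - ereal (blinfun_apply \<xi> (y - x))) / ereal (norm (y - x)))}"


subsection \<open>Mirror flows and EVI solutions\<close>

text \<open>Curves are functions on \<^typ>\<open>real\<close>, of which only the values at times \<open>t \<ge> 0\<close> matter.\<close>

definition locally_abs_cont :: "(real \<Rightarrow> 'b::real_normed_vector) \<Rightarrow> bool" where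
  "locally_abs_cont u \<longleftrightarrow>
     (\<exists>A :: real \<Rightarrow> real.
        (\<forall>T\<ge>0. set_integrable lebesgue {0..T} A) \<and>
        (\<forall>s t. 0 \<le> s \<longrightarrow> s \<le> t \<longrightarrow>
           norm (u t - u s) \<le> set_lebesgue_integral lebesgue {s..t} A))"

definition mirror_flow ::
    "('v::real_normed_vector \<Rightarrow> real) \<Rightarrow> ('v \<Rightarrow> ereal) \<Rightarrow> (real \<Rightarrow> 'v) \<Rightarrow> bool" where
  "mirror_flow \<Psi> \<Phi> x \<longleftrightarrow>
     locally_abs_cont (\<lambda>t. grad \<Psi> (x t)) \<and>
     (AE t in lebesgue. 0 < t \<longrightarrow>
        (\<exists>\<xi>\<in>frechet_subdiff \<Phi> (x t).
           ((\<lambda>r. grad \<Psi> (x r)) has_vector_derivative - \<xi>) (at t)))"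

definition E_fun :: "real \<Rightarrow> real \<Rightarrow> real" where
  "E_fun lam t = integral {0..t} (\<lambda>r. exp (lam * r))"

text \<open>
  For \<open>s = t\<close> the right-hand side is \<open>0\<close>, even if \<open>\<Phi> (x t) = \<infinity>\<close>, since \<open>0 * (-\<infinity>) = 0\<close> in
  \<^typ>\<open>ereal\<close>.
\<close>

definition EVI_solution ::
    "real \<Rightarrow> ('v \<Rightarrow> 'v \<Rightarrow> real) \<Rightarrow> ('v \<Rightarrow> ereal) \<Rightarrow> (real \<Rightarrow> 'v) \<Rightarrow> bool" where
  "EVI_solution lam D \<Phi> x \<longleftrightarrow>
     (\<forall>s t. 0 \<le> s \<longrightarrow> s \<le> t \<longrightarrow> (\<forall>y\<in>eff_dom \<Phi>.
        ereal (exp (lam * (t - s)) * D y (x t) - D y (x s))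
          \<le> ereal (E_fun lam (t - s)) * (\<Phi> y - \<Phi> (x t))))"

text \<open>
  Uniform lower bound on a divergence on the dual.  The only pair at which \<open>g\<close> is evaluated at \<open>0\<close>
  is \<open>(0,0)\<close>, where the convention \<open>\<infinity> * 0 = 0\<close> makes the left-hand side \<open>0\<close>; with a
  real-valued \<open>g\<close> the left-hand side is \<open>0\<close> there too, whatever \<open>g 0\<close> is.
\<close>

definition dual_lower_bound ::
    "(real \<Rightarrow> real) \<Rightarrow> ('w::real_normed_vector \<Rightarrow> 'w \<Rightarrow> real) \<Rightarrow> bool" where
  "dual_lower_bound g D \<longleftrightarrow>
     (\<forall>\<phi> \<psi>. g (norm \<phi> + norm \<psi>) * (norm (\<phi> - \<psi>))\<^sup>2 \<le> D \<phi> \<psi>)"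

end

theory Submission
  imports Defs "HOL-Probability.Distribution_Functions"
begin

text \<open>
  Write \<open>\<xi>\<^sub>t = \<nabla>\<Psi>(x\<^sub>t)\<close>.  The identity
  \<open>D(y, x\<^sub>s) - D(y, x\<^sub>t) = \<langle>\<xi>\<^sub>t - \<xi>\<^sub>s, y - x\<^sub>t\<rangle> + D(x\<^sub>t, x\<^sub>s)\<close>, in which coercivity makes the last term
  \<open>o(\<bar>s - t\<bar>)\<close>, shows that \<open>D(y, x\<^sub>t)\<close> has derivative \<open>- \<langle>\<xi>'\<^sub>t, y - x\<^sub>t\<rangle>\<close> wherever \<open>\<xi>\<close> is
  differentiable.  For a mirror flow, relative convexity turns this into
  \<open>d/dt D(y, x\<^sub>t) + \<lambda> D(y, x\<^sub>t) \<le> \<Phi>(y) - \<Phi>(x\<^sub>t)\<close> for almost every \<open>t\<close>; integrating it gives the EVI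
  once \<open>\<Phi>\<close> is known to decrease along the flow, and the same inequality with \<open>y\<close> on the curve, combined
  with lower semicontinuity, gives that monotonicity.  Conversely, differentiating the EVI shows that
  \<open>- \<xi>'\<^sub>t\<close> is a subgradient; here the Radon--Nikodym property is what provides \<open>\<xi>'\<^sub>t\<close>.
\<close>

subsection \<open>Increments dominated by a measure\<close>

text \<open>Test points \<open>y\<close> range over an uncountable set, so exceptional null sets
  depending on \<open>y\<close> could not be collected. Differentiating
  \<open>grad \<Psi> (x t)\<close> in the norm of the dual yields one null set that serves every
  \<open>y\<close>.

  Absolute continuity is used in the form of increments dominated by a finite Borel measure
  \<open>\<nu>\<close>. Outer regularity of \<open>\<nu>\<close> then replaces the integration of
  almost everywhere derivatives, and a single \<open>\<nu>\<close> controls the divergences, the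
  exponential weights and their products.

  Along a mirror flow \<open>\<Phi> (x t)\<close> is not known in advance to be absolutely
  continuous, or even finite at every time. The differential inequality is therefore only integrated
  with a constant in place of \<open>\<Phi> y - \<Phi> (x r)\<close>: 0 for monotonicity, the value
  at the final time for the EVI.

  The dual may be non-separable, where differences of Borel maps can fail to be Borel. Vector-valued
  densities \<open>g\<close> enter only through the real functions \<open>norm (g - c)\<close> with
  \<open>c\<close> fixed.\<close>

lemma measure_density_lborel:
  fixes h :: "real \<Rightarrow> real"
  assumes h: "integrable lborel h" "\<And>x. 0 \<le> h x" and E: "E \<in> sets borel"
  shows "measure (density lborel h) E = (\<integral>x. indicator E x * h x \<partial>lborel)"
proof -
  have [measurable]: "h \<in> borel_measurable borel" "E \<in> sets borel"
    using h E by auto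
  have i: "integrable lborel (\<lambda>x. indicator E x * h x)"
    using integrable_mult_indicator[OF _ h(1), of E] E by simp
  have "emeasure (density lborel h) E = (\<integral>\<^sup>+x. ennreal (indicator E x * h x) \<partial>lborel)"
    by (subst emeasure_density) (auto intro!: nn_integral_cong split: split_indicator)
  also have "\<dots> = ennreal (\<integral>x. indicator E x * h x \<partial>lborel)"
    by (rule nn_integral_eq_integral[OF i]) (auto simp: h)
  finally show ?thesis
    by (auto simp: measure_def h intro!: enn2real_ennreal integral_nonneg_AE)
qed

lemma finite_measure_density_lborel:
  fixes h :: "real \<Rightarrow> real"
  assumes h: "integrable lborel h" "\<And>x. 0 \<le> h x"
  shows "finite_measure (density lborel h)"
proof
  have [measurable]: "h \<in> borel_measurable borel"
    using h by auto
  have "emeasure (density lborel h) (space (density lborel h)) = (\<integral>\<^sup>+x. ennreal (h x) \<partial>lborel)"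
    by (subst emeasure_density) auto
  also have "\<dots> = ennreal (\<integral>x. h x \<partial>lborel)"
    by (rule nn_integral_eq_integral[OF h(1)]) (auto simp: h)
  finally show "emeasure (density lborel h) (space (density lborel h)) \<noteq> \<infinity>"
    by simp
qed

text \<open>The majorant \<open>A\<close> is only Lebesgue measurable and may change sign, so the
  density of \<open>\<nu>\<close> is built from the absolute value of a Borel version of it on
  \<open>{0..T}\<close>. Adding 1 to the density makes \<open>\<nu>\<close> dominate length: smooth
  functions then have increments controlled by \<open>\<nu>\<close>, and no nondegenerate interval
  inside \<open>{0..T}\<close> is \<open>\<nu>\<close>-null.\<close>

lemma locally_abs_cont_dominating_measure:
  assumes "locally_abs_cont u"
  obtains \<nu> where "finite_measure \<nu>" "sets \<nu> = sets borel"
    "null_sets (density lborel (indicator {0..T::real})) \<subseteq> null_sets \<nu>"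
    "\<And>s t. 0 \<le> s \<Longrightarrow> s \<le> t \<Longrightarrow> t \<le> T \<Longrightarrow> norm (u t - u s) \<le> measure \<nu> {s<..t}"
    "\<And>s t. 0 \<le> s \<Longrightarrow> s \<le> t \<Longrightarrow> t \<le> T \<Longrightarrow> t - s \<le> measure \<nu> {s<..t}"
proof -
  obtain A where A: "\<And>T. T \<ge> 0 \<Longrightarrow> set_integrable lebesgue {0..T} A"
    and uA: "\<And>s t. 0 \<le> s \<Longrightarrow> s \<le> t \<Longrightarrow> norm (u t - u s) \<le> set_lebesgue_integral lebesgue {s..t} A"
    using assms unfolding locally_abs_cont_def by blast
  define f where "f = (\<lambda>r. indicator {0..T} r * A r)"
  have fint: "integrable lebesgue f"
    using A[of T] unfolding f_def set_integrable_def by (cases "0 \<le> T") auto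
  obtain f' where f'[measurable]: "f' \<in> borel_measurable borel" and ff': "AE x in lborel. f x = f' x"
    using completion_ex_borel_measurable_real[of f lborel] fint by auto
  have ffl: "AE x in lebesgue. f x = f' x"
    using AE_completion[OF ff'] .
  have "integrable lebesgue f'"
    using fint ffl by (subst integrable_cong_AE[of _ _ f]) (auto intro: measurable_completion)
  then have f'int: "integrable lborel f'"
    by (simp add: integrable_completion)
  define h where "h = (\<lambda>r. indicator {0..T} r * (\<bar>f' r\<bar> + 1))"
  have [measurable]: "h \<in> borel_measurable borel"
    unfolding h_def by measurable
  have h0: "0 \<le> h x" for x
    unfolding h_def by auto
  have h_int: "integrable lborel h"
  proof -
    have "integrable lborel (\<lambda>r. indicator {0..T} r *\<^sub>R \<bar>f' r\<bar> + indicat_real {0..T} r)"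
      by (intro Bochner_Integration.integrable_add integrable_mult_indicator integrable_abs f'int)
        (auto simp: integrable_indicator_iff emeasure_lborel_Icc_eq)
    then show ?thesis
      unfolding h_def by (simp add: algebra_simps)
  qed
  define \<nu> where "\<nu> = density lborel h"
  have \<nu>: "measure \<nu> E = (\<integral>x. indicator E x * h x \<partial>lborel)" if "E \<in> sets borel" for E
    unfolding \<nu>_def using measure_density_lborel[OF h_int h0 that] .
  show thesis
  proof (rule that[of \<nu>])
    show "finite_measure \<nu>"
      unfolding \<nu>_def by (rule finite_measure_density_lborel[OF h_int h0])
    show "sets \<nu> = sets borel"
      by (simp add: \<nu>_def)
    show "null_sets (density lborel (indicator {0..T})) \<subseteq> null_sets \<nu>"
    proof
      fix N assume "N \<in> null_sets (density lborel (indicator {0..T}))"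
      then have N: "N \<in> sets lborel" "AE x in lborel. x \<in> N \<longrightarrow> indicator {0..T} x \<le> (0::ennreal)"
        by (subst (asm) null_sets_density_iff; simp)+
      have "AE x in lborel. x \<in> N \<longrightarrow> ennreal (h x) \<le> 0"
        using N(2) by eventually_elim (auto simp: h_def split: split_indicator)
      then show "N \<in> null_sets \<nu>"
        unfolding \<nu>_def using N(1) by (subst null_sets_density_iff) auto
    qed
    fix s t :: real assume st: "0 \<le> s" "s \<le> t" "t \<le> T"
    have ih: "integrable lborel (\<lambda>x. indicator {s<..t} x * h x)"
      using integrable_mult_indicator[OF _ h_int, of "{s<..t}"] by simp
    have if': "integrable lborel (\<lambda>x. indicator {s<..t} x * f' x)"
      using integrable_mult_indicator[OF _ f'int, of "{s<..t}"] by simp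
    have "set_lebesgue_integral lebesgue {s..t} A = (\<integral>x. indicator {s<..t} x * f' x \<partial>lebesgue)"
      unfolding set_lebesgue_integral_def
    proof (rule integral_cong_AE)
      show "(\<lambda>x. indicat_real {s..t} x *\<^sub>R A x) \<in> borel_measurable lebesgue"
      proof -
        have "(\<lambda>x. indicat_real {s..t} x *\<^sub>R f x) \<in> borel_measurable lebesgue"
          using fint by (intro borel_measurable_scaleR borel_measurable_indicator) auto
        moreover have "(\<lambda>x. indicat_real {s..t} x *\<^sub>R f x) = (\<lambda>x. indicat_real {s..t} x *\<^sub>R A x)"
          using st by (auto simp: f_def fun_eq_iff split: split_indicator)
        ultimately show ?thesis by simp
      qed
      show "(\<lambda>x. indicat_real {s<..t} x * f' x) \<in> borel_measurable lebesgue"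
        by (intro measurable_completion) simp
      \<comment> \<open>The closed interval of the definition and the half-open one of
        \<open>\<nu>\<close> differ by the null set \<open>{s}\<close>.\<close>
      have "AE x in lebesgue. x \<noteq> s"
        by (rule AE_completion[OF AE_lborel_singleton])
      then show "AE x in lebesgue. indicat_real {s..t} x *\<^sub>R A x = indicat_real {s<..t} x * f' x"
        using ffl by eventually_elim (use st in \<open>auto simp: f_def split: split_indicator\<close>)
    qed
    also have "\<dots> = (\<integral>x. indicator {s<..t} x * f' x \<partial>lborel)"
      by (rule integral_completion) simp
    also have "\<dots> \<le> (\<integral>x. indicator {s<..t} x * h x \<partial>lborel)"
      by (rule integral_mono[OF if' ih]) (use st in \<open>auto simp: h_def split: split_indicator\<close>)
    finally show "norm (u t - u s) \<le> measure \<nu> {s<..t}"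
      using uA[of s t] st by (simp add: \<nu>)
    have "t - s = (\<integral>x. indicator {s<..t} x \<partial>lborel)"
      using st by simp
    also have "\<dots> \<le> (\<integral>x. indicator {s<..t} x * h x \<partial>lborel)"
      by (rule integral_mono[OF _ ih])
        (use st in \<open>auto simp: h_def integrable_indicator_iff split: split_indicator\<close>)
    finally show "t - s \<le> measure \<nu> {s<..t}"
      by (simp add: \<nu>)
  qed
qed

lemma finite_measure_outer_open:
  fixes \<nu> :: "'a::{second_countable_topology, complete_space} measure"
  assumes "finite_measure \<nu>" and s: "sets \<nu> = sets borel" and H: "H \<in> sets borel" and "0 < \<epsilon>"
  obtains U where "open U" "H \<subseteq> U" "measure \<nu> (U - H) < \<epsilon>"
proof -
  interpret finite_measure \<nu> by fact
  have "emeasure \<nu> H = (INF U \<in> {U. H \<subseteq> U \<and> open U}. emeasure \<nu> U)"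
    by (rule outer_regular[OF s _ H]) simp
  moreover have "emeasure \<nu> H < emeasure \<nu> H + ennreal \<epsilon>"
    using \<open>0 < \<epsilon>\<close> by (simp add: emeasure_eq_measure ennreal_less_iff flip: ennreal_plus)
  ultimately obtain U where U: "H \<subseteq> U" "open U" "emeasure \<nu> U < emeasure \<nu> H + ennreal \<epsilon>"
    by (metis (no_types, lifting) INF_less_iff mem_Collect_eq)
  have "measure \<nu> U < measure \<nu> H + \<epsilon>"
    using U(3) \<open>0 < \<epsilon>\<close> by (simp add: emeasure_eq_measure ennreal_less_iff flip: ennreal_plus)
  moreover have "measure \<nu> (U - H) = measure \<nu> U - measure \<nu> H"
    using U H s by (intro finite_measure_Diff) auto
  ultimately show thesis
    using that[of U] U by auto
qed

text \<open>Off the null set the derivative controls increments; near it an open set of small measure does.\<close>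

lemma nonincreasing_if_AE_deriv_nonpos:
  fixes u :: "real \<Rightarrow> real"
  assumes "finite_measure \<nu>" and s: "sets \<nu> = sets borel" and N: "N \<in> null_sets \<nu>"
    and "a \<le> b" "0 \<le> C"
    and bound: "\<And>p q. a \<le> p \<Longrightarrow> p \<le> q \<Longrightarrow> q \<le> b \<Longrightarrow> \<bar>u q - u p\<bar> \<le> C * measure \<nu> {p<..q}"
    and deriv: "\<And>t. t \<in> {a..b} \<Longrightarrow> t \<notin> N \<Longrightarrow> \<exists>D\<le>0. (u has_real_derivative D) (at t)"
  shows "u b \<le> u a"
proof -
  interpret finite_measure \<nu> by fact
  have "u b - u a \<le> \<epsilon> * (b - a + C)" if "0 < \<epsilon>" for \<epsilon>
  proof -
    obtain U where U: "open U" "N \<subseteq> U" "measure \<nu> (U - N) < \<epsilon>"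
      using finite_measure_outer_open[OF assms(1) s, of N \<epsilon>] N s \<open>0 < \<epsilon>\<close> by auto
    have mU: "measure \<nu> U < \<epsilon>"
      using U N s by (subst (asm) measure_Diff_null_set) auto
    have [measurable]: "U \<in> sets \<nu>" "{p<..q::real} \<in> sets \<nu>" for p q
      using U s by auto
    \<comment> \<open>Both error terms are additive over adjacent intervals, as the bisection
      principle \<open>Bolzano\<close> requires; the guards make \<open>P\<close> vacuous for
      intervals leaving \<open>{a..b}\<close>.\<close>
    define P where "P = (\<lambda>p q. a \<le> p \<longrightarrow> p \<le> q \<longrightarrow> q \<le> b \<longrightarrow>
        u q - u p \<le> \<epsilon> * (q - p) + C * measure \<nu> (U \<inter> {p<..q}))"
    have "P a b"
      using \<open>a \<le> b\<close>
    proof (induction rule: Bolzano)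
      case (trans p q r)
      show ?case
        unfolding P_def
      proof (intro impI)
        assume "a \<le> p" "p \<le> r" "r \<le> b"
        have "U \<inter> {p<..r} = (U \<inter> {p<..q}) \<union> (U \<inter> {q<..r})"
          using trans by auto
        then have "measure \<nu> (U \<inter> {p<..r}) = measure \<nu> (U \<inter> {p<..q}) + measure \<nu> (U \<inter> {q<..r})"
          by (simp only:) (rule finite_measure_Union; auto)
        with trans \<open>a \<le> p\<close> \<open>r \<le> b\<close>
        show "u r - u p \<le> \<epsilon> * (r - p) + C * measure \<nu> (U \<inter> {p<..r})"
          unfolding P_def by (simp add: algebra_simps)
      qed
    next
      case (local x)
      show ?case
      proof (cases "x \<in> N")
        case True
        then obtain d where d: "0 < d" "ball x d \<subseteq> U"
          using U by (meson open_contains_ball subsetD)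
        show ?thesis
        proof (intro exI[of _ d] conjI allI impI d)
          fix p q assume pq: "p \<le> x \<and> x \<le> q \<and> q - p < d"
          then have "{p<..q} \<subseteq> ball x d"
            by (auto simp: dist_real_def)
          then have "U \<inter> {p<..q} = {p<..q}"
            using d by auto
          moreover have "0 \<le> \<epsilon> * (q - p)"
            using \<open>0 < \<epsilon>\<close> pq by simp
          ultimately show "P p q"
            unfolding P_def using bound[of p q] by (auto simp: abs_le_iff)
        qed
      next
        case False
        with deriv[of x] local obtain D where D: "D \<le> 0" "(u has_real_derivative D) (at x)"
          by auto
        then obtain d where d: "0 < d"
          and dd: "\<And>y. norm (y - x) < d \<Longrightarrow> norm (u y - u x - D * (y - x)) \<le> \<epsilon> * norm (y - x)"
          using \<open>0 < \<epsilon>\<close> unfolding has_field_derivative_def has_derivative_at_alt by blast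
        show ?thesis
        proof (intro exI[of _ d] conjI allI impI d)
          fix p q assume pq: "p \<le> x \<and> x \<le> q \<and> q - p < d"
          \<comment> \<open>Differentiability at \<open>x\<close> is applied to the two halves of
            the interval separately; both linear terms have the favourable sign because
            \<open>D \<le> 0\<close>.\<close>
          have "u q - u x - D * (q - x) \<le> \<epsilon> * (q - x)" "u x - u p + D * (p - x) \<le> \<epsilon> * (x - p)"
            using dd[of q] dd[of p] pq by (simp_all add: abs_le_iff algebra_simps)
          moreover have "D * (q - x) \<le> 0" "0 \<le> D * (p - x)"
            using D pq by (auto simp: mult_nonpos_nonneg mult_nonpos_nonpos)
          ultimately have "u q - u p \<le> \<epsilon> * (q - p)"
            by (simp add: algebra_simps)
          then show "P p q"
            unfolding P_def using \<open>0 \<le> C\<close> by (simp add: add_increasing2)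
        qed
      qed
    qed
    then have "u b - u a \<le> \<epsilon> * (b - a) + C * measure \<nu> (U \<inter> {a<..b})"
      unfolding P_def using \<open>a \<le> b\<close> by simp
    moreover have "C * measure \<nu> (U \<inter> {a<..b}) \<le> C * \<epsilon>"
      using finite_measure_mono[of "U \<inter> {a<..b}" U] mU \<open>0 \<le> C\<close> by (intro mult_left_mono) auto
    ultimately show ?thesis
      by (simp add: algebra_simps)
  qed
  note * = this
  show ?thesis
  proof (rule ccontr)
    assume "\<not> u b \<le> u a"
    \<comment> \<open>Half the gap divided by \<open>K\<close> is taken for \<epsilon>. The summand
      1 keeps \<open>K\<close> positive when \<open>a = b\<close> and \<open>C = 0\<close>.\<close>
    define K where "K = b - a + C + 1"
    have "K > 0" using assms unfolding K_def by auto
    have "u b - u a \<le> (u b - u a) / (2 * K) * (b - a + C)"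
      using \<open>\<not> _\<close> \<open>K > 0\<close> by (intro *) auto
    also have "\<dots> \<le> (u b - u a) / (2 * K) * K"
      using \<open>\<not> _\<close> \<open>K > 0\<close> by (intro mult_left_mono) (auto simp: K_def)
    also have "\<dots> = (u b - u a) / 2"
      using \<open>K > 0\<close> by simp
    finally show False using \<open>\<not> _\<close> by simp
  qed
qed

subsection \<open>Lebesgue differentiation on the line\<close>

text \<open>If the bound fails at \<open>t\<close>, there are rationals \<open>q < p\<close> with
  \<open>h t < q\<close> such that arbitrarily short intervals around \<open>t\<close> have
  \<open>\<nu>\<close>-average above \<open>p\<close>. A Vitali covering by such intervals, inside
  an open \<open>U\<close> slightly larger than \<open>H = {h < q}\<close>, has a union
  \<open>W\<close> with \<open>p |W| \<le> \<nu> W \<le> q |W| + \<nu> (U - H)\<close>, so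
  \<open>W\<close> is small. The upper estimate suffices because it is applied to distances
  \<open>norm (g - c)\<close>; \<open>t\<close> may be an endpoint, as one-sided difference
  quotients require.\<close>

lemma AE_upper_density_le:
  fixes h :: "real \<Rightarrow> real"
  assumes h: "integrable lborel h" "\<And>x. 0 \<le> h x"
  defines "\<nu> \<equiv> density lborel h"
  shows "AE t in lborel. \<forall>\<epsilon>>0. \<exists>\<delta>>0. \<forall>a b. a \<le> t \<longrightarrow> t \<le> b \<longrightarrow> b - a < \<delta> \<longrightarrow>
    measure \<nu> {a<..b} \<le> (h t + \<epsilon>) * (b - a)"
proof -
  interpret \<nu>: finite_measure \<nu>
    unfolding \<nu>_def by (rule finite_measure_density_lborel[OF h])
  have [measurable]: "h \<in> borel_measurable borel"
    using h by auto
  have [simp]: "sets \<nu> = sets borel"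
    by (simp add: \<nu>_def)
  define E where "E = (\<lambda>q p. {t. h t < q \<and>
    (\<forall>\<delta>>0. \<exists>a b. a \<le> t \<and> t \<le> b \<and> b - a < \<delta> \<and> p * (b - a) < measure \<nu> {a<..b})})"
  have negl: "negligible (E q p)" if "q < p" for q p
  proof (cases "E q p = {}")
    case False
    then have "0 < q"
      unfolding E_def using h(2) by (force intro: le_less_trans)
    define H where "H = {t. h t < q}"
    have [measurable]: "H \<in> sets borel"
      unfolding H_def by measurable
    show ?thesis
      unfolding negligible_outer_le
    proof (intro allI impI)
      fix e :: real assume "0 < e"
      \<comment> \<open>The factor \<open>p - q\<close> anticipates the final division: the covering
        will give \<open>(p - q) |W| \<le> \<nu> (U - H)\<close>.\<close>
      then have "0 < e * (p - q)"
        using \<open>q < p\<close> by simp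
      then obtain U where U: "open U" "H \<subseteq> U" "measure \<nu> (U - H) < e * (p - q)"
        using finite_measure_outer_open[OF \<nu>.finite_measure_axioms, of H] by auto
      have [measurable]: "U \<in> sets borel"
        using U by auto
      define K where "K = {(c, r). ball c r \<subseteq> U \<and> p * (2 * r) < measure \<nu> (ball c r)}"
      have cov: "\<exists>i. i \<in> K \<and> x \<in> ball (fst i) (snd i) \<and> snd i < d" if x: "x \<in> E q p" and "0 < d" for x d
      proof -
        have "x \<in> U"
          using x U unfolding E_def H_def by auto
        then obtain d0 where d0: "0 < d0" "ball x d0 \<subseteq> U"
          using \<open>open U\<close> open_contains_ball by blast
        \<comment> \<open>The quarter leaves room for the enlargement below: the ball keeps a radius
          below \<open>d\<close> and stays within \<open>d0\<close> of \<open>x\<close>.\<close>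
        define \<delta> where "\<delta> = min d d0 / 4"
        have "0 < \<delta>" "\<delta> \<le> d / 4" "\<delta> \<le> d0 / 4"
          using d0 \<open>0 < d\<close> by (auto simp: \<delta>_def)
        then obtain a b where ab: "a \<le> x" "x \<le> b" "b - a < \<delta>" "p * (b - a) < measure \<nu> {a<..b}"
          using x unfolding E_def by auto
        \<comment> \<open>Balls are open, so the interval is widened by \<open>\<eta>\<close> on
          both sides. This costs \<open>2 * p * \<eta>\<close>, at most half of the gap between
          \<open>\<nu>\<close> of the interval and \<open>p * (b - a)\<close>.\<close>
        define \<eta> where "\<eta> = min \<delta> ((measure \<nu> {a<..b} - p * (b - a)) / (4 * p))"
        have "0 < p"
          using \<open>0 < q\<close> \<open>q < p\<close> by simp
        then have "0 < \<eta>" "\<eta> \<le> \<delta>"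
          using ab \<open>0 < \<delta>\<close> by (auto simp: \<eta>_def)
        have "\<eta> \<le> (measure \<nu> {a<..b} - p * (b - a)) / (4 * p)"
          by (simp add: \<eta>_def)
        then have "p * (4 * \<eta>) \<le> measure \<nu> {a<..b} - p * (b - a)"
          using \<open>0 < p\<close> by (simp add: field_simps)
        moreover have "0 < p * (2 * \<eta>)"
          using \<open>0 < p\<close> \<open>0 < \<eta>\<close> by simp
        moreover have "2 * ((b - a) / 2 + \<eta>) = b - a + 2 * \<eta>"
          by simp
        ultimately have less: "p * (2 * ((b - a) / 2 + \<eta>)) < measure \<nu> {a<..b}"
          by (simp only:) (simp add: algebra_simps)
        define c r where "c = (a + b) / 2" and "r = (b - a) / 2 + \<eta>"
        have "{a<..b} \<subseteq> ball c r" "x \<in> ball c r"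
          using \<open>0 < \<eta>\<close> ab by (auto simp: dist_real_def c_def r_def abs_less_iff field_simps)
        have "ball c r \<subseteq> ball x d0"
        proof
          fix y assume "y \<in> ball c r"
          then have "\<bar>c - y\<bar> < r"
            by (simp add: dist_real_def)
          moreover have "\<bar>c - x\<bar> \<le> (b - a) / 2"
            using ab unfolding c_def by (simp add: abs_le_iff field_simps)
          moreover have "\<bar>x - y\<bar> \<le> \<bar>c - y\<bar> + \<bar>c - x\<bar>"
            by simp
          ultimately have "\<bar>x - y\<bar> < b - a + \<eta>"
            unfolding r_def by argo
          then show "y \<in> ball x d0"
            using \<open>\<eta> \<le> \<delta>\<close> ab \<open>\<delta> \<le> d0 / 4\<close> \<open>0 < d0\<close> by (simp add: dist_real_def)
        qed
        moreover have "measure \<nu> {a<..b} \<le> measure \<nu> (ball c r)"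
          using \<open>{a<..b} \<subseteq> ball c r\<close> by (intro \<nu>.finite_measure_mono) auto
        ultimately have "(c, r) \<in> K"
          using d0 less unfolding K_def r_def by auto
        moreover have "r < d"
          using \<open>\<eta> \<le> \<delta>\<close> ab(3) \<open>\<delta> \<le> d / 4\<close> \<open>0 < d\<close> unfolding r_def by argo
        ultimately show ?thesis
          using \<open>x \<in> ball c r\<close> by (intro exI[of _ "(c, r)"]) auto
      qed
      obtain C where C: "countable C" "C \<subseteq> K"
          "pairwise (\<lambda>i j. disjnt (ball (fst i) (snd i)) (ball (fst j) (snd j))) C"
          "negligible (E q p - (\<Union>i\<in>C. ball (fst i) (snd i)))"
        by (rule Vitali_covering_theorem_balls[of "E q p" K fst snd]) (use cov in blast)+
      define W where "W = (\<Union>i\<in>C. ball (fst i) (snd i))"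
      have [measurable]: "W \<in> sets borel"
        unfolding W_def by (intro borel_open open_UN) auto
      have "W \<subseteq> U"
      proof -
        have "ball (fst i) (snd i) \<subseteq> U" if "i \<in> K" for i
          using that unfolding K_def by (simp add: split_beta)
        then show ?thesis
          using C(2) unfolding W_def by blast
      qed
      have disj: "disjoint_family_on (\<lambda>i. ball (fst i) (snd i)) C"
        using C(3) by (auto simp: disjoint_family_on_def pairwise_def disjnt_def)
      have "0 < p"
        using \<open>0 < q\<close> \<open>q < p\<close> by simp
      have "ennreal p * emeasure lborel W = (\<integral>\<^sup>+i. ennreal p * emeasure lborel (ball (fst i) (snd i)) \<partial>count_space C)"
        unfolding W_def using C(1) disj
        by (subst emeasure_UN_countable) (auto simp: nn_integral_cmult)
      also have "\<dots> \<le> (\<integral>\<^sup>+i. emeasure \<nu> (ball (fst i) (snd i)) \<partial>count_space C)"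
      proof (rule nn_integral_mono)
        fix i assume "i \<in> space (count_space C)"
        then have i: "p * (2 * snd i) < measure \<nu> (ball (fst i) (snd i))"
          using C(2) unfolding K_def by auto
        have "emeasure lborel (ball (fst i) (snd i)) = ennreal (2 * snd i)"
        proof (cases "0 < snd i")
          case True
          then show ?thesis
            by (simp add: ball_eq_greaterThanLessThan)
        next
          \<comment> \<open>\<open>K\<close> does contain pairs of negative radius: their ball is
            empty and the condition reads \<open>p * (2 * r) < 0\<close>.\<close>
          case False
          then show ?thesis
            by (simp add: ennreal_neg ball_empty)
        qed
        then have "ennreal p * emeasure lborel (ball (fst i) (snd i)) = ennreal (p * (2 * snd i))"
          using \<open>0 < p\<close> by (simp add: ennreal_mult')
        also have "\<dots> \<le> emeasure \<nu> (ball (fst i) (snd i))"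
          using i by (simp add: \<nu>.emeasure_eq_measure ennreal_leI)
        finally show "ennreal p * emeasure lborel (ball (fst i) (snd i)) \<le> emeasure \<nu> (ball (fst i) (snd i))" .
      qed
      also have "\<dots> = emeasure \<nu> W"
        unfolding W_def using C(1) disj by (subst emeasure_UN_countable) auto
      finally have pW: "ennreal p * emeasure lborel W \<le> emeasure \<nu> W" .
      have fin: "emeasure lborel W \<noteq> \<infinity>"
        using pW \<open>0 < p\<close> by (auto simp: \<nu>.emeasure_eq_measure ennreal_mult_top top_unique)
      have W_eq: "emeasure lborel W = ennreal (measure lborel W)"
        using fin by (simp add: emeasure_eq_ennreal_measure)
      have "p * measure lborel W \<le> measure \<nu> W"
        using pW \<open>0 < p\<close>
        by (simp add: W_eq \<nu>.emeasure_eq_measure ennreal_le_iff flip: ennreal_mult')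
      also have "measure \<nu> W \<le> measure \<nu> (W \<inter> H) + measure \<nu> (U - H)"
      proof -
        have "measure \<nu> W \<le> measure \<nu> ((W \<inter> H) \<union> (U - H))"
          using \<open>W \<subseteq> U\<close> by (intro \<nu>.finite_measure_mono) auto
        also have "\<dots> \<le> measure \<nu> (W \<inter> H) + measure \<nu> (U - H)"
          by (rule measure_Un_le) auto
        finally show ?thesis .
      qed
      also have "measure \<nu> (W \<inter> H) \<le> q * measure lborel W"
      proof -
        have "emeasure \<nu> (W \<inter> H) = (\<integral>\<^sup>+x. ennreal (h x) * indicator (W \<inter> H) x \<partial>lborel)"
          unfolding \<nu>_def by (rule emeasure_density) auto
        also have "\<dots> \<le> (\<integral>\<^sup>+x. ennreal q * indicator W x \<partial>lborel)"
          by (rule nn_integral_mono) (auto simp: H_def intro!: ennreal_leI split: split_indicator)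
        also have "\<dots> = ennreal (q * measure lborel W)"
          using \<open>0 < q\<close> by (simp add: nn_integral_cmult_indicator W_eq ennreal_mult')
        finally show ?thesis
          using \<open>0 < q\<close> by (simp add: \<nu>.emeasure_eq_measure)
      qed
      finally have "(p - q) * measure lborel W \<le> (p - q) * e"
        using U(3) by (simp add: algebra_simps)
      then have We: "measure lborel W \<le> e"
        using \<open>q < p\<close> by simp
      have Wl: "W \<in> lmeasurable"
        using fin by (simp add: fmeasurable_def top.not_eq_extremum)
      show "\<exists>T. E q p \<subseteq> T \<and> T \<in> lmeasurable \<and> measure lebesgue T \<le> e"
      proof (intro exI conjI)
        let ?Z = "E q p - W"
        have Z: "?Z \<in> lmeasurable" "measure lebesgue ?Z = 0"
          using C(4) by (simp_all add: W_def negligible_iff_measure)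
        show "E q p \<subseteq> W \<union> ?Z" by auto
        show "W \<union> ?Z \<in> lmeasurable"
          by (rule fmeasurable.Un[OF Wl Z(1)])
        have "measure lebesgue (W \<union> ?Z) \<le> measure lebesgue W + measure lebesgue ?Z"
          using Wl Z by (intro measure_Un_le) auto
        then show "measure lebesgue (W \<union> ?Z) \<le> e"
          using We Z(2) by simp
      qed
    qed
  qed auto
  define N where "N = (\<Union>(q, p)\<in>{(q, p). q \<in> \<rat> \<and> p \<in> \<rat> \<and> q < p}. E q p)"
  have "countable {(q, p). q \<in> \<rat> \<and> p \<in> \<rat> \<and> q < (p::real)}"
    by (rule countable_subset[of _ "\<rat> \<times> \<rat>"]) (auto simp: countable_rat)
  then have "negligible N"
    unfolding N_def by (intro negligible_countable_Union[OF countable_image]) (auto intro!: negl)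
  then obtain N' where "N' \<in> null_sets lborel" "N \<subseteq> N'"
    by (auto simp: negligible_iff_null_sets null_sets_completion_iff2)
  then show ?thesis
  proof (intro AE_I'[of N'] subsetI, simp)
    fix t assume "t \<in> {t \<in> space lborel. \<not> (\<forall>\<epsilon>>0. \<exists>\<delta>>0. \<forall>a b. a \<le> t \<longrightarrow> t \<le> b \<longrightarrow> b - a < \<delta> \<longrightarrow>
      measure \<nu> {a<..b} \<le> (h t + \<epsilon>) * (b - a))}"
    then obtain \<epsilon> where "0 < \<epsilon>" and \<epsilon>: "\<And>\<delta>. 0 < \<delta> \<Longrightarrow> \<exists>a b. a \<le> t \<and> t \<le> b \<and> b - a < \<delta> \<and>
        (h t + \<epsilon>) * (b - a) < measure \<nu> {a<..b}"
      by (auto simp: not_le)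
    obtain p where p: "p \<in> \<rat>" "h t < p" "p < h t + \<epsilon>"
      using Rats_dense_in_real[of "h t" "h t + \<epsilon>"] \<open>0 < \<epsilon>\<close> by auto
    obtain q where q: "q \<in> \<rat>" "h t < q" "q < p"
      using Rats_dense_in_real[of "h t" p] p by auto
    have "t \<in> E q p"
      unfolding E_def
    proof (intro CollectI conjI allI impI)
      fix \<delta> :: real assume "0 < \<delta>"
      from \<epsilon>[OF this] obtain a b where ab: "a \<le> t" "t \<le> b" "b - a < \<delta>"
          "(h t + \<epsilon>) * (b - a) < measure \<nu> {a<..b}"
        by auto
      have "p * (b - a) \<le> (h t + \<epsilon>) * (b - a)"
        using p ab by (intro mult_right_mono) auto
      with ab show "\<exists>a b. a \<le> t \<and> t \<le> b \<and> b - a < \<delta> \<and> p * (b - a) < measure \<nu> {a<..b}"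
        by (intro exI[of _ a] exI[of _ b]) auto
    qed (fact q)
    then have "t \<in> N"
      using p q unfolding N_def by auto
    with \<open>N \<subseteq> N'\<close> show "t \<in> N'" by auto
  qed
qed

subsection \<open>Differentiability of curves in duals with the Radon--Nikodym property\<close>

lemma simple_bochner_integral_scaled_indicator:
  assumes "finite_measure M" "E \<in> sets M"
  shows "Bochner_Integration.simple_bochner_integrable M (\<lambda>\<omega>. indicator E \<omega> *\<^sub>R c)"
    and "Bochner_Integration.simple_bochner_integral M (\<lambda>\<omega>. indicator E \<omega> *\<^sub>R c) = measure M E *\<^sub>R c"
proof -
  interpret finite_measure M by fact
  have ind: "Bochner_Integration.simple_bochner_integrable M (indicat_real E)"
    using assms(2) by (auto intro!: simple_bochner_integrable.intros simple_function_indicator)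
  show "Bochner_Integration.simple_bochner_integrable M (\<lambda>\<omega>. indicator E \<omega> *\<^sub>R c)"
    using simple_bochner_integrable_compose2[of "\<lambda>x y. x *\<^sub>R c", OF _ ind ind] by simp
  have "ennreal (Bochner_Integration.simple_bochner_integral M (indicat_real E)) = (\<integral>\<^sup>+\<omega>. ennreal (indicator E \<omega>) \<partial>M)"
    by (rule simple_bochner_integral_eq_nn_integral[OF ind]) simp
  also have "\<dots> = ennreal (measure M E)"
    using assms(2) by (simp add: emeasure_eq_measure ennreal_indicator)
  finally have "Bochner_Integration.simple_bochner_integral M (indicat_real E) = measure M E"
    by (subst (asm) ennreal_inj) auto
  moreover have "Bochner_Integration.simple_bochner_integral M (\<lambda>\<omega>. indicator E \<omega> *\<^sub>R c) =
      Bochner_Integration.simple_bochner_integral M (indicat_real E) *\<^sub>R c"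
    by (rule simple_bochner_integral_linear[OF _ ind]) (simp add: linear_scaleR_left)
  ultimately show "Bochner_Integration.simple_bochner_integral M (\<lambda>\<omega>. indicator E \<omega> *\<^sub>R c) = measure M E *\<^sub>R c"
    by simp
qed

text \<open>Needed because subtraction need not be Borel measurable in a non-separable space.\<close>

lemma measurable_norm_diff_simple_function:
  fixes f s :: "'a \<Rightarrow> 'b::real_normed_vector"
  assumes [measurable]: "f \<in> borel_measurable M" and s: "simple_function M s"
  shows "(\<lambda>\<omega>. norm (f \<omega> - s \<omega>)) \<in> borel_measurable M"
proof (rule measurable_compose_countable'[where g = s and I = "s ` space M"])
  fix c
  have "continuous_on UNIV (\<lambda>y::'b. norm (y - c))"
    by (intro continuous_intros)
  from borel_measurable_continuous_onI[OF this]
  show "(\<lambda>\<omega>. norm (f \<omega> - c)) \<in> borel_measurable M"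
    by (rule measurable_compose[rotated]) fact
next
  show "s \<in> M \<rightarrow>\<^sub>M count_space (s ` space M)"
    using s unfolding simple_function_def by (subst measurable_count_space_eq2) auto
qed (use s in \<open>auto simp: simple_function_def intro: countable_finite\<close>)

text \<open>The approximating simple functions satisfy this up to their \<open>L^1\<close> distance
  from the integrand, which tends to 0. It reduces estimates of a vector-valued integral to the real
  functions \<open>norm (g \<omega> - c)\<close>.\<close>

lemma has_Bochner_integral_norm_diff_le:
  fixes g :: "'a \<Rightarrow> 'b::real_normed_vector"
  assumes M: "finite_measure M" and E: "E \<in> sets M"
    and I: "has_Bochner_integral M (\<lambda>\<omega>. indicator E \<omega> *\<^sub>R g \<omega>) I"
  shows "ennreal (norm (I - measure M E *\<^sub>R c)) \<le> (\<integral>\<^sup>+\<omega>. ennreal (indicator E \<omega> * norm (g \<omega> - c)) \<partial>M)"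
proof -
  interpret finite_measure M by fact
  define f where "f = (\<lambda>\<omega>. indicator E \<omega> *\<^sub>R g \<omega>)"
  define k where "k = (\<lambda>\<omega>. indicator E \<omega> *\<^sub>R c)"
  note k = simple_bochner_integral_scaled_indicator[OF M E, of c, folded k_def]
  obtain s where f: "f \<in> borel_measurable M"
    and s: "\<And>i::nat. Bochner_Integration.simple_bochner_integrable M (s i)"
    and l: "(\<lambda>i. \<integral>\<^sup>+\<omega>. ennreal (norm (f \<omega> - s i \<omega>)) \<partial>M) \<longlonglongrightarrow> 0"
    and sI: "(\<lambda>i. Bochner_Integration.simple_bochner_integral M (s i)) \<longlonglongrightarrow> I"
    using I unfolding has_Bochner_integral_def f_def by blast
  have sf: "simple_function M (s i)" "simple_function M k" for i
    using s[of i] k by (auto elim: simple_bochner_integrable.cases)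
  note [measurable] = measurable_norm_diff_simple_function[OF f sf(1)]
    measurable_norm_diff_simple_function[OF f sf(2)]
  have "ennreal (norm (Bochner_Integration.simple_bochner_integral M (s i) - measure M E *\<^sub>R c))
      \<le> (\<integral>\<^sup>+\<omega>. ennreal (norm (f \<omega> - s i \<omega>)) \<partial>M) + (\<integral>\<^sup>+\<omega>. ennreal (norm (f \<omega> - k \<omega>)) \<partial>M)" for i
  proof -
    have "ennreal (norm (Bochner_Integration.simple_bochner_integral M (s i) - measure M E *\<^sub>R c)) =
        norm (Bochner_Integration.simple_bochner_integral M (\<lambda>\<omega>. s i \<omega> - k \<omega>))"
      using s k by (subst simple_bochner_integral_diff) auto
    also have "\<dots> \<le> Bochner_Integration.simple_bochner_integral M (\<lambda>\<omega>. norm (s i \<omega> - k \<omega>))"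
      using simple_bochner_integrable_compose2[of "(-)" M "s i" k] s k
      by (auto intro!: simple_bochner_integral_norm_bound)
    also have "\<dots> = (\<integral>\<^sup>+\<omega>. norm (s i \<omega> - k \<omega>) \<partial>M)"
      using simple_bochner_integrable_compose2[of "\<lambda>x y. norm (x - y)" M "s i" k] s k
      by (auto intro!: simple_bochner_integral_eq_nn_integral)
    also have "\<dots> \<le> (\<integral>\<^sup>+\<omega>. ennreal (norm (f \<omega> - s i \<omega>)) + ennreal (norm (f \<omega> - k \<omega>)) \<partial>M)"
    proof (rule nn_integral_mono)
      fix \<omega>
      have "norm (s i \<omega> - k \<omega>) \<le> norm (f \<omega> - s i \<omega>) + norm (f \<omega> - k \<omega>)"
        using norm_triangle_ineq4[of "f \<omega> - k \<omega>" "f \<omega> - s i \<omega>"] by (simp add: add.commute)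
      then show "ennreal (norm (s i \<omega> - k \<omega>)) \<le> ennreal (norm (f \<omega> - s i \<omega>)) + ennreal (norm (f \<omega> - k \<omega>))"
        by (metis ennreal_leI ennreal_plus norm_ge_zero)
    qed
    also have "\<dots> = (\<integral>\<^sup>+\<omega>. ennreal (norm (f \<omega> - s i \<omega>)) \<partial>M) + (\<integral>\<^sup>+\<omega>. ennreal (norm (f \<omega> - k \<omega>)) \<partial>M)"
      by (rule nn_integral_add) auto
    finally show ?thesis .
  qed
  moreover have "(\<lambda>i. ennreal (norm (Bochner_Integration.simple_bochner_integral M (s i) - measure M E *\<^sub>R c)))
      \<longlonglongrightarrow> ennreal (norm (I - measure M E *\<^sub>R c))"
    by (intro tendsto_ennrealI tendsto_intros sI)
  moreover have "(\<lambda>i. (\<integral>\<^sup>+\<omega>. ennreal (norm (f \<omega> - s i \<omega>)) \<partial>M) + (\<integral>\<^sup>+\<omega>. ennreal (norm (f \<omega> - k \<omega>)) \<partial>M))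
      \<longlonglongrightarrow> 0 + (\<integral>\<^sup>+\<omega>. ennreal (norm (f \<omega> - k \<omega>)) \<partial>M)"
    by (intro tendsto_add l tendsto_const)
  ultimately have "ennreal (norm (I - measure M E *\<^sub>R c)) \<le> 0 + (\<integral>\<^sup>+\<omega>. ennreal (norm (f \<omega> - k \<omega>)) \<partial>M)"
    by (intro LIMSEQ_le[of "\<lambda>i. ennreal (norm (Bochner_Integration.simple_bochner_integral M (s i) - measure M E *\<^sub>R c))"]) blast+
  also have "\<dots> = (\<integral>\<^sup>+\<omega>. ennreal (indicator E \<omega> * norm (g \<omega> - c)) \<partial>M)"
    by (auto intro!: nn_integral_cong simp: f_def k_def split: split_indicator)
  finally show ?thesis .
qed

text \<open>The values of all approximating simple functions form a countable set, and
  \<open>L^1\<close> convergence forces the distance of \<open>g \<omega>\<close> from it to vanish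
  almost everywhere. One of these functions is within \<open>L^1\<close> distance 1 of
  \<open>g\<close>; being bounded on a finite measure space, it makes the integral of
  \<open>norm (g - c)\<close> finite.\<close>

lemma has_Bochner_integral_approx_countable:
  fixes g :: "'a \<Rightarrow> 'b::real_normed_vector"
  assumes M: "finite_measure M" and I: "has_Bochner_integral M g I"
  obtains C where "countable C" "AE \<omega> in M. g \<omega> \<in> closure C"
    "\<And>c. (\<integral>\<^sup>+\<omega>. ennreal (norm (g \<omega> - c)) \<partial>M) < \<infinity>"
proof -
  interpret finite_measure M by fact
  obtain s where g: "g \<in> borel_measurable M"
    and s: "\<And>i::nat. Bochner_Integration.simple_bochner_integrable M (s i)"
    and l: "(\<lambda>i. \<integral>\<^sup>+\<omega>. ennreal (norm (g \<omega> - s i \<omega>)) \<partial>M) \<longlonglongrightarrow> 0"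
    using I unfolding has_Bochner_integral_def by blast
  have sf: "simple_function M (s i)" for i
    using s[of i] by (auto elim: simple_bochner_integrable.cases)
  note [measurable] = measurable_norm_diff_simple_function[OF g sf]
  \<comment> \<open>The extra \<open>0\<close> keeps \<open>C\<close> nonempty:
    \<open>infdist\<close> to the empty set is 0 by convention and would say nothing about
    closures.\<close>
  define C where "C = insert 0 (\<Union>i. s i ` space M)"
  have "countable C"
    using sf unfolding C_def simple_function_def by (auto intro: countable_finite)
  moreover have "AE \<omega> in M. g \<omega> \<in> closure C"
  proof -
    have meas: "(\<lambda>\<omega>. infdist (g \<omega>) C) \<in> borel_measurable M"
      by (rule measurable_compose[OF g borel_measurable_continuous_onI]) (intro continuous_intros)
    have "(\<integral>\<^sup>+\<omega>. ennreal (infdist (g \<omega>) C) \<partial>M) \<le> (\<integral>\<^sup>+\<omega>. ennreal (norm (g \<omega> - s i \<omega>)) \<partial>M)" for i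
      by (intro nn_integral_mono ennreal_leI infdist_le2[of "s i _"]) (auto simp: C_def dist_norm)
    then have "(\<integral>\<^sup>+\<omega>. ennreal (infdist (g \<omega>) C) \<partial>M) \<le> 0"
      by (intro LIMSEQ_le_const[OF l]) auto
    then have "AE \<omega> in M. ennreal (infdist (g \<omega>) C) = 0"
      using meas by (subst (asm) le_zero_eq, subst (asm) nn_integral_0_iff_AE) auto
    then show ?thesis
    proof eventually_elim
      case (elim \<omega>)
      then have "infdist (g \<omega>) C = 0"
        using infdist_nonneg[of "g \<omega>" C] by (simp add: ennreal_eq_0_iff)
      then show ?case
        by (subst in_closure_iff_infdist_zero) (auto simp: C_def)
    qed
  qed
  moreover have "(\<integral>\<^sup>+\<omega>. ennreal (norm (g \<omega> - c)) \<partial>M) < \<infinity>" for c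
  proof -
    have "eventually (\<lambda>i. (\<integral>\<^sup>+\<omega>. ennreal (norm (g \<omega> - s i \<omega>)) \<partial>M) < 1) sequentially"
      by (rule order_tendstoD(2)[OF l]) simp
    then obtain i where i: "(\<integral>\<^sup>+\<omega>. ennreal (norm (g \<omega> - s i \<omega>)) \<partial>M) < 1"
      by (auto simp: eventually_sequentially)
    define B where "B = Max (insert 0 ((\<lambda>y. norm (y - c)) ` s i ` space M))"
    have B: "norm (s i \<omega> - c) \<le> B" if "\<omega> \<in> space M" for \<omega>
      using sf[of i] that unfolding B_def simple_function_def by (intro Max_ge) auto
    have "(\<integral>\<^sup>+\<omega>. ennreal (norm (g \<omega> - c)) \<partial>M) \<le> (\<integral>\<^sup>+\<omega>. ennreal (norm (g \<omega> - s i \<omega>)) + ennreal B \<partial>M)"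
    proof (rule nn_integral_mono)
      fix \<omega> assume "\<omega> \<in> space M"
      have "norm (g \<omega> - c) \<le> norm (g \<omega> - s i \<omega>) + norm (s i \<omega> - c)"
        by (rule norm_diff_triangle_le[OF order_refl order_refl])
      with B[OF \<open>\<omega> \<in> space M\<close>]
      show "ennreal (norm (g \<omega> - c)) \<le> ennreal (norm (g \<omega> - s i \<omega>)) + ennreal B"
        by (subst ennreal_plus[symmetric]) (auto intro!: ennreal_leI intro: order_trans[OF norm_ge_zero])
    qed
    also have "\<dots> = (\<integral>\<^sup>+\<omega>. ennreal (norm (g \<omega> - s i \<omega>)) \<partial>M) + ennreal B * emeasure M (space M)"
      by (subst nn_integral_add) auto
    also have "\<dots> < \<infinity>"
      using i by (auto simp: emeasure_eq_measure ennreal_mult_eq_top_iff less_top[symmetric])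
    finally show ?thesis .
  qed
  ultimately show thesis
    by (rule that)
qed

text \<open>A Dynkin argument over half-open intervals. The complement step needs
  \<open>\<phi> UNIV = 0\<close>; as the line is not in the generator, this comes from a partition
  into unit intervals. Applied to differences, the lemma is a uniqueness statement, and it will give
  linearity in the direction \<open>v\<close>.\<close>

lemma signed_measure_eq_0_if_Ioc:
  fixes \<phi> :: "real set \<Rightarrow> real"
  assumes sums: "\<And>A::nat \<Rightarrow> real set. range A \<subseteq> sets borel \<Longrightarrow> disjoint_family A \<Longrightarrow>
      (\<lambda>i. \<phi> (A i)) sums \<phi> (\<Union>i. A i)"
    and Ioc: "\<And>a b. \<phi> {a<..b} = 0"
    and E: "E \<in> sets borel"
  shows "\<phi> E = 0"
proof -
  let ?G = "range (\<lambda>(a, b). {a<..b::real})"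
  have borel: "sets borel = sigma_sets UNIV ?G"
    by (subst borel_sigma_sets_Ioc) (simp add: sets_measure_of)
  have empty: "\<phi> {} = 0"
    using Ioc[of 0 0] by simp
  have UNIV: "\<phi> UNIV = 0"
  proof -
    define A where "A n = {real_of_int (int_decode n)<..real_of_int (int_decode n) + 1}" for n
    have un: "(\<Union>n. A n) = UNIV"
    proof (intro set_eqI iffI)
      fix x :: real
      \<comment> \<open>The intervals are open on the left, so an integer lies in the one that ends
        there: ceiling minus one, not the floor.\<close>
      have "x \<in> A (int_encode (\<lceil>x\<rceil> - 1))"
        unfolding A_def by (auto; linarith)
      then show "x \<in> (\<Union>n. A n)" by blast
    qed auto
    have "disjoint_family A"
      unfolding disjoint_family_on_def
    proof (intro ballI impI)
      fix m n :: nat assume "m \<noteq> n"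
      then have "int_decode m \<noteq> int_decode n"
        by (metis int_decode_inverse)
      then show "A m \<inter> A n = {}"
        unfolding A_def by (auto; linarith)
    qed
    moreover have "range A \<subseteq> sets borel"
      by (auto simp: A_def)
    ultimately have "(\<lambda>i. \<phi> (A i)) sums \<phi> (\<Union>n. A n)"
      by (intro sums)
    moreover have "(\<lambda>i. \<phi> (A i)) sums 0"
      by (simp add: A_def Ioc)
    ultimately show ?thesis
      unfolding un by (rule sums_unique2)
  qed
  have "Int_stable ?G"
  proof (rule Int_stableI)
    fix A B assume "A \<in> ?G" "B \<in> ?G"
    then obtain a b c d where "A = {a<..b}" "B = {c<..d}" by auto
    then have "A \<inter> B = {max a c<..min b d}" by auto
    then show "A \<inter> B \<in> ?G" by auto
  qed
  moreover have "?G \<subseteq> Pow UNIV" by auto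
  moreover have "E \<in> sigma_sets UNIV ?G"
    using E borel by simp
  ultimately show ?thesis
  proof (induction rule: sigma_sets_induct_disjoint)
    case (basic A)
    then show ?case by (auto simp: Ioc)
  next
    case empty
    then show ?case by (rule \<open>\<phi> {} = 0\<close>)
  next
    case (compl A)
    then have [measurable]: "A \<in> sets borel"
      by (simp add: borel)
    have "disjoint_family (binaryset A (UNIV - A))"
      by (auto simp: disjoint_family_on_def binaryset_def)
    then have "(\<lambda>i. \<phi> (binaryset A (UNIV - A) i)) sums \<phi> (\<Union>i. binaryset A (UNIV - A) i)"
      by (intro sums) (auto simp: range_binaryset_eq)
    moreover have "(\<lambda>i. \<phi> (binaryset A (UNIV - A) i)) sums (\<phi> A + \<phi> (UNIV - A))"
      by (rule binaryset_sums[of \<phi>, OF \<open>\<phi> {} = 0\<close>])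
    ultimately have "\<phi> A + \<phi> (UNIV - A) = \<phi> UNIV"
      by (simp add: UN_binaryset_eq sums_unique2)
    then show ?case
      using compl UNIV by simp
  next
    case (union A)
    then have "(\<lambda>i. \<phi> (A i)) sums \<phi> (\<Union>i. A i)"
      by (intro sums) (simp_all add: borel)
    with union show ?case
      by (simp add: sums_iff)
  qed
qed

text \<open>
  For each direction \<open>v\<close> the nondecreasing function \<open>\<parallel>v\<parallel> \<nu>{..t} + \<xi>\<^sub>t v\<close> has a Stieltjes measure; subtracting
  \<open>\<parallel>v\<parallel> \<nu>\<close> again leaves the Stieltjes measure of \<open>\<xi> v\<close>.
\<close>

lemma dual_stieltjes_measure:
  fixes \<xi> :: "real \<Rightarrow> 'v::real_normed_vector \<Rightarrow>\<^sub>L real"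
  assumes \<nu>: "finite_measure \<nu>" "sets \<nu> = sets borel"
    and \<xi>: "\<And>s t. s \<le> t \<Longrightarrow> norm (\<xi> t - \<xi> s) \<le> measure \<nu> {s<..t}"
  obtains G :: "real set \<Rightarrow> 'v \<Rightarrow>\<^sub>L real" where
    "\<And>a b. a \<le> b \<Longrightarrow> G {a<..b} = \<xi> b - \<xi> a"
    "\<And>E. E \<in> sets borel \<Longrightarrow> norm (G E) \<le> measure \<nu> E"
    "\<And>A::nat \<Rightarrow> real set. range A \<subseteq> sets borel \<Longrightarrow> disjoint_family A \<Longrightarrow> (\<lambda>i. G (A i)) sums G (\<Union>i. A i)"
proof -
  interpret finite_borel_measure \<nu>
    using \<nu> by (simp add: finite_borel_measure_def finite_borel_measure_axioms_def)
  have K: "measure \<nu> {s<..t} = cdf \<nu> t - cdf \<nu> s" if "s \<le> t" for s t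
    using cdf_diff_eq[of s t] that by (cases "s = t") auto
  have \<xi>v: "\<bar>\<xi> t v - \<xi> s v\<bar> \<le> norm v * (cdf \<nu> t - cdf \<nu> s)" if "s \<le> t" for s t v
  proof -
    have "\<bar>\<xi> t v - \<xi> s v\<bar> \<le> norm (\<xi> t - \<xi> s) * norm v"
      using norm_blinfun[of "\<xi> t - \<xi> s" v] by (simp add: blinfun.diff_left)
    also have "\<dots> \<le> (cdf \<nu> t - cdf \<nu> s) * norm v"
      using \<xi>[OF that] K[OF that] by (intro mult_right_mono) auto
    finally show ?thesis by (simp add: mult.commute)
  qed
  define F where "F v t = norm v * cdf \<nu> t + \<xi> t v" for v t
  define m where "m v = interval_measure (F v)" for v
  have F_mono: "F v s \<le> F v t" if "s \<le> t" for v s t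
    using \<xi>v[OF that, of v] unfolding F_def by (simp add: abs_le_iff algebra_simps)
  \<comment> \<open>Right continuity, which \<open>interval_measure\<close> requires, passes from
    the cdf to \<open>\<xi> t v\<close>, whose increments it dominates.\<close>
  have F_cont: "continuous (at_right a) (F v)" for v a
  proof -
    have c: "(cdf \<nu> \<longlongrightarrow> cdf \<nu> a) (at_right a)"
      using cdf_is_right_cont[of a] by (simp add: continuous_within)
    have "((\<lambda>t. \<xi> t v - \<xi> a v) \<longlongrightarrow> 0) (at_right a)"
    proof (rule Lim_null_comparison)
      show "\<forall>\<^sub>F t in at_right a. norm (\<xi> t v - \<xi> a v) \<le> norm v * (cdf \<nu> t - cdf \<nu> a)"
        using \<xi>v by (auto simp: eventually_at_right_less intro!: eventually_at_rightI[of a "a + 1"])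
      show "((\<lambda>t. norm v * (cdf \<nu> t - cdf \<nu> a)) \<longlongrightarrow> 0) (at_right a)"
        by (rule tendsto_eq_intros c refl | simp)+
    qed
    then have "((\<lambda>t. \<xi> t v) \<longlongrightarrow> \<xi> a v) (at_right a)"
      by (simp add: LIM_zero_iff)
    then show ?thesis
      unfolding continuous_within F_def using c by (intro tendsto_add tendsto_mult tendsto_const)
  qed
  have m_Ioc: "measure (m v) {a<..b} = F v b - F v a" if "a \<le> b" for v a b
    unfolding m_def by (rule measure_interval_measure_Ioc[OF that F_mono F_cont])
  have m_sets [simp]: "sets (m v) = sets borel" for v
    by (simp add: m_def)
  have m_fin: "finite_measure (m v)" for v
  proof
    have inc: "incseq (\<lambda>n. {- real n<..real n})"
      by (auto simp: incseq_def)
    have "(\<Union>n. {- real n<..real n}) = UNIV"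
    proof (intro set_eqI iffI)
      fix x :: real
      obtain n where "\<bar>x\<bar> < real n" using reals_Archimedean2 by blast
      then have "x \<in> {- real n<..real n}" by auto
      then show "x \<in> (\<Union>n. {- real n<..real n})" by blast
    qed auto
    with inc have lim: "(\<lambda>n. emeasure (m v) {- real n<..real n}) \<longlonglongrightarrow> emeasure (m v) UNIV"
      using Lim_emeasure_incseq[of "\<lambda>n. {- real n<..real n}" "m v"] by (simp add: image_subset_iff)
    \<comment> \<open>The factor 2 counts the cdf term and the \<open>\<xi>\<close> term of
      \<open>F\<close>; each contributes at most \<open>norm v\<close> times the mass of
      \<open>\<nu>\<close>.\<close>
    have "emeasure (m v) {- real n<..real n} \<le> ennreal (2 * norm v * measure \<nu> UNIV)" for n
    proof -
      have "emeasure (m v) {- real n<..real n} = ennreal (F v (real n) - F v (- real n))"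
        unfolding m_def by (rule emeasure_interval_measure_Ioc[OF _ F_mono F_cont]) auto
      also have "F v (real n) - F v (- real n) \<le> 2 * norm v * measure \<nu> {- real n<..real n}"
        using \<xi>v[of "- real n" "real n" v] unfolding F_def
        by (simp add: K abs_le_iff algebra_simps)
      also have "\<dots> \<le> 2 * norm v * measure \<nu> UNIV"
        by (intro mult_left_mono finite_measure_mono) (auto simp: \<nu>(2))
      finally show ?thesis by (simp add: ennreal_leI)
    qed
    then have "emeasure (m v) UNIV \<le> ennreal (2 * norm v * measure \<nu> UNIV)"
      by (intro LIMSEQ_le_const2[OF lim]) auto
    then show "emeasure (m v) (space (m v)) \<noteq> \<infinity>"
      by (auto simp: m_def top_unique)
  qed
  define \<mu> where "\<mu> v E = measure (m v) E - norm v * measure \<nu> E" for v E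
  have \<mu>_sums: "(\<lambda>i. \<mu> v (A i)) sums \<mu> v (\<Union>i. A i)"
    if "range A \<subseteq> sets borel" "disjoint_family A" for v and A :: "nat \<Rightarrow> real set"
    unfolding \<mu>_def using that
    by (intro sums_diff sums_mult finite_measure.finite_measure_UNION[OF m_fin] finite_measure_UNION)
      (simp_all add: \<nu>(2))
  have \<mu>_Ioc: "\<mu> v {a<..b} = (if a \<le> b then \<xi> b v - \<xi> a v else 0)" for v a b
    unfolding \<mu>_def by (auto simp: m_Ioc K F_def algebra_simps)
  \<comment> \<open>\<open>m v\<close> involves \<open>norm v\<close>, so linearity in
    \<open>v\<close> is not visible from the construction. On half-open intervals the norm terms
    cancel, and uniqueness carries the identity to all Borel sets.\<close>
  have \<mu>_add: "\<mu> (v + w) E = \<mu> v E + \<mu> w E" if "E \<in> sets borel" for v w E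
  proof -
    have "\<mu> (v + w) E - (\<mu> v E + \<mu> w E) = 0"
      using that
      by (rule signed_measure_eq_0_if_Ioc[rotated 2])
        (auto intro!: sums_diff sums_add \<mu>_sums simp: \<mu>_Ioc blinfun.add_right)
    then show ?thesis by simp
  qed
  have \<mu>_scale: "\<mu> (c *\<^sub>R v) E = c * \<mu> v E" if "E \<in> sets borel" for c v E
  proof -
    have "\<mu> (c *\<^sub>R v) E - c * \<mu> v E = 0"
      using that
      by (rule signed_measure_eq_0_if_Ioc[rotated 2])
        (auto intro!: sums_diff sums_mult \<mu>_sums simp: \<mu>_Ioc blinfun.scaleR_right algebra_simps)
    then show ?thesis by simp
  qed
  have \<mu>_bound: "\<bar>\<mu> v E\<bar> \<le> measure \<nu> E * norm v" if E: "E \<in> sets borel" for v E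
  proof -
    \<comment> \<open>Nonnegativity of \<open>m v\<close> gives a lower bound only; the upper bound
      is the same fact for \<open>-v\<close>.\<close>
    have "- (measure \<nu> E * norm v) \<le> \<mu> v E" "- (measure \<nu> E * norm v) \<le> \<mu> (-v) E"
      by (simp_all add: \<mu>_def)
    moreover have "\<mu> (-v) E = - \<mu> v E"
      using \<mu>_scale[OF E, of "-1" v] by simp
    ultimately show ?thesis by linarith
  qed
  define G where "G E = Blinfun (\<lambda>v. \<mu> v E)" for E
  have G: "blinfun_apply (G E) v = \<mu> v E" if "E \<in> sets borel" for E v
    unfolding G_def
    by (subst bounded_linear_Blinfun_apply)
      (auto intro!: bounded_linear_intro[where K = "measure \<nu> E"] simp: that \<mu>_add \<mu>_scale \<mu>_bound[simplified mult.commute])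
  have G_norm: "norm (G E) \<le> measure \<nu> E" if "E \<in> sets borel" for E
    by (rule norm_blinfun_bound) (auto simp: G that \<mu>_bound)
  show thesis
  proof (rule that[of G])
    show "G {a<..b} = \<xi> b - \<xi> a" if "a \<le> b" for a b
      by (rule blinfun_eqI) (simp add: G \<mu>_Ioc that blinfun.diff_left)
    fix A :: "nat \<Rightarrow> real set" assume A: "range A \<subseteq> sets borel" "disjoint_family A"
    \<comment> \<open>Domination by \<open>\<nu>\<close> gives convergence in the norm of the dual;
      the limit is then identified by testing with each \<open>v\<close>.\<close>
    have "summable (\<lambda>i. measure \<nu> (A i))"
      using finite_measure_UNION[of A] A by (auto simp: \<nu>(2) sums_iff)
    then have "summable (\<lambda>i. G (A i))"
      by (rule summable_comparison_test'[where N = 0]) (use A in \<open>auto intro!: G_norm\<close>)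
    moreover have "(\<Sum>i. G (A i)) = G (\<Union>i. A i)"
    proof (rule blinfun_eqI)
      fix v
      have "(\<lambda>i. blinfun_apply (G (A i)) v) sums blinfun_apply (\<Sum>i. G (A i)) v"
        by (rule bounded_linear.sums[OF blinfun.bounded_linear_left summable_sums]) fact
      moreover have "(\<lambda>i. blinfun_apply (G (A i)) v) = (\<lambda>i. \<mu> v (A i))"
        using A by (auto simp: G)
      moreover have "blinfun_apply (G (\<Union>i. A i)) v = \<mu> v (\<Union>i. A i)"
        using A by (intro G) auto
      ultimately show "blinfun_apply (\<Sum>i. G (A i)) v = blinfun_apply (G (\<Union>i. A i)) v"
        using \<mu>_sums[OF A, of v] by (metis sums_unique2)
    qed
    ultimately show "(\<lambda>i. G (A i)) sums G (\<Union>i. A i)"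
      by (simp add: sums_iff)
  qed (fact G_norm)
qed

text \<open>The Stieltjes measure of \<open>u\<close> has a density \<open>g\<close>, and
  \<open>u b - u a - (b - a) *\<^sub>R c\<close> is the integral of \<open>g - c\<close> over
  \<open>{a<..b}\<close> for every constant \<open>c\<close>. Differentiating the integrals of
  \<open>norm (g - c)\<close> for countably many \<open>c\<close>, whose closure contains almost
  every value of \<open>g\<close>, and picking \<open>c\<close> close to \<open>g t\<close> gives
  the derivative \<open>g t\<close>.\<close>

lemma radon_nikodym_AE_differentiable_on:
  fixes u :: "real \<Rightarrow> 'v::real_normed_vector \<Rightarrow>\<^sub>L real"
  assumes RNP: "radon_nikodym_property TYPE('v \<Rightarrow>\<^sub>L real)" and u: "locally_abs_cont u" and "0 \<le> T"
  shows "AE t in lborel. 0 < t \<longrightarrow> t < T \<longrightarrow> (\<exists>d. (u has_vector_derivative d) (at t))"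
proof -
  define M where "M = density lborel (indicator {0..T})"
  obtain \<nu> where \<nu>: "finite_measure \<nu>" "sets \<nu> = sets borel" "null_sets M \<subseteq> null_sets \<nu>"
    and u\<nu>: "\<And>s t. 0 \<le> s \<Longrightarrow> s \<le> t \<Longrightarrow> t \<le> T \<Longrightarrow> norm (u t - u s) \<le> measure \<nu> {s<..t}"
    unfolding M_def by (rule locally_abs_cont_dominating_measure[OF u, of T]) blast
  interpret \<nu>: finite_measure \<nu> by fact
  have [simp]: "sets M = sets borel" "space M = UNIV"
    by (simp_all add: M_def)
  have M_em: "emeasure M E = emeasure lborel (E \<inter> {0..T})" if [measurable]: "E \<in> sets borel" for E
    unfolding M_def by (subst emeasure_density) (auto simp: Int_commute simp flip: indicator_inter_arith)
  have "finite_measure M"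
    by standard (simp add: M_em emeasure_lborel_Icc_eq)
  then interpret M: finite_measure M .
  \<comment> \<open>Clamping time to \<open>{0..T}\<close> extends the curve to the whole line with
    increments still dominated by \<open>\<nu>\<close>.\<close>
  define \<xi> where "\<xi> t = u (max 0 (min T t))" for t
  have "norm (\<xi> t - \<xi> s) \<le> measure \<nu> {s<..t}" if "s \<le> t" for s t
  proof -
    have "norm (\<xi> t - \<xi> s) \<le> measure \<nu> {max 0 (min T s)<..max 0 (min T t)}"
      unfolding \<xi>_def using that \<open>0 \<le> T\<close> by (intro u\<nu>) auto
    also have "\<dots> \<le> measure \<nu> {s<..t}"
      using \<nu>(2) by (intro \<nu>.finite_measure_mono) auto
    finally show ?thesis .
  qed
  then obtain G :: "real set \<Rightarrow> 'v \<Rightarrow>\<^sub>L real" where G_Ioc: "\<And>a b. a \<le> b \<Longrightarrow> G {a<..b} = \<xi> b - \<xi> a"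
    and G_norm: "\<And>E. E \<in> sets borel \<Longrightarrow> norm (G E) \<le> measure \<nu> E"
    and G_sums: "\<And>A::nat \<Rightarrow> real set. range A \<subseteq> sets borel \<Longrightarrow> disjoint_family A \<Longrightarrow>
      (\<lambda>i. G (A i)) sums G (\<Union>i. A i)"
    using dual_stieltjes_measure[OF \<nu>(1,2), of \<xi>] by metis
  have "vector_measure M G"
    unfolding vector_measure_def using G_sums by simp
  moreover have "bounded_variation_measure M G"
    unfolding bounded_variation_measure_def
  proof (intro exI[of _ "measure \<nu> UNIV"] allI impI)
    fix P :: "real set set" assume P: "finite P" "P \<subseteq> sets M" "disjoint P"
    have "(\<Sum>E\<in>P. norm (G E)) \<le> (\<Sum>E\<in>P. measure \<nu> E)"
      using P by (intro sum_mono G_norm) auto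
    also have "\<dots> = measure \<nu> (\<Union>E\<in>P. E)"
      using P \<nu>(2) by (intro \<nu>.finite_measure_finite_Union[symmetric])
        (auto simp: disjoint_family_on_def disjoint_def)
    also have "\<dots> \<le> measure \<nu> UNIV"
      using \<nu>(2) by (intro \<nu>.finite_measure_mono) auto
    finally show "(\<Sum>E\<in>P. norm (G E)) \<le> measure \<nu> UNIV" .
  qed
  moreover have "abs_cont_measure M G"
    unfolding abs_cont_measure_def
  proof
    fix E assume E: "E \<in> null_sets M"
    then have "E \<in> null_sets \<nu>"
      using \<nu>(3) by auto
    then show "G E = 0"
      using G_norm[of E] E by (auto simp: null_sets_def measure_eq_0_null_sets)
  qed
  ultimately obtain g where g: "\<And>E. E \<in> sets borel \<Longrightarrow> has_Bochner_integral M (\<lambda>\<omega>. indicator E \<omega> *\<^sub>R g \<omega>) (G E)"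
    using RNP M.finite_measure_axioms unfolding radon_nikodym_property_def radon_nikodym_wrt_def
    by fastforce
  have gU: "has_Bochner_integral M g (G UNIV)"
    using g[of UNIV] by simp
  obtain C where C: "countable C" "AE \<omega> in M. g \<omega> \<in> closure C"
    and C_fin: "\<And>c. (\<integral>\<^sup>+\<omega>. ennreal (norm (g \<omega> - c)) \<partial>M) < \<infinity>"
    using has_Bochner_integral_approx_countable[OF M.finite_measure_axioms gU] by metis
  have g_meas: "g \<in> borel_measurable borel"
    using gU by (simp add: has_Bochner_integral_def measurable_def)
  define h where "h c \<omega> = indicator {0..T} \<omega> * norm (g \<omega> - c)" for c \<omega>
  have norm_meas [measurable]: "(\<lambda>\<omega>. norm (g \<omega> - c)) \<in> borel_measurable borel" for c
    by (rule measurable_compose[OF g_meas borel_measurable_continuous_onI]) (intro continuous_intros)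
  have h0: "0 \<le> h c \<omega>" for c \<omega>
    by (simp add: h_def)
  have h_int: "integrable lborel (h c)" for c
  proof (rule integrableI_bounded)
    show "h c \<in> borel_measurable lborel"
      unfolding h_def by measurable
    have "(\<integral>\<^sup>+\<omega>. ennreal (norm (g \<omega> - c)) \<partial>M) = (\<integral>\<^sup>+\<omega>. indicator {0..T} \<omega> * ennreal (norm (g \<omega> - c)) \<partial>lborel)"
      unfolding M_def by (rule nn_integral_density) measurable
    also have "\<dots> = (\<integral>\<^sup>+\<omega>. ennreal (norm (h c \<omega>)) \<partial>lborel)"
      by (auto intro!: nn_integral_cong simp: h_def split: split_indicator)
    finally show "(\<integral>\<^sup>+\<omega>. ennreal (norm (h c \<omega>)) \<partial>lborel) < \<infinity>"
      using C_fin[of c] by simp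
  qed
  have incr: "norm (u b - u a - (b - a) *\<^sub>R c) \<le> measure (density lborel (h c)) {a<..b}"
    if ab: "0 \<le> a" "a \<le> b" "b \<le> T" for a b c
  proof -
    interpret h: finite_measure "density lborel (h c)"
      by (rule finite_measure_density_lborel[OF h_int h0])
    have "measure M {a<..b} = b - a"
    proof -
      have "{a<..b} \<inter> {0..T} = {a<..b}"
        using ab by auto
      then show ?thesis
        using ab by (simp add: measure_def M_em)
    qed
    moreover have "G {a<..b} = u b - u a"
      using ab by (simp add: G_Ioc \<xi>_def)
    ultimately have "ennreal (norm (u b - u a - (b - a) *\<^sub>R c))
        \<le> (\<integral>\<^sup>+\<omega>. ennreal (indicator {a<..b} \<omega> * norm (g \<omega> - c)) \<partial>M)"
      using has_Bochner_integral_norm_diff_le[OF M.finite_measure_axioms _ g, of "{a<..b}" c] by simp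
    also have "\<dots> = (\<integral>\<^sup>+\<omega>. indicator {0..T} \<omega> * ennreal (indicator {a<..b} \<omega> * norm (g \<omega> - c)) \<partial>lborel)"
      unfolding M_def by (rule nn_integral_density) measurable
    also have "\<dots> = (\<integral>\<^sup>+\<omega>. ennreal (h c \<omega>) * indicator {a<..b} \<omega> \<partial>lborel)"
      by (auto intro!: nn_integral_cong simp: h_def split: split_indicator)
    also have "\<dots> = emeasure (density lborel (h c)) {a<..b}"
      using borel_measurable_integrable[OF h_int[of c]] by (intro emeasure_density[symmetric]) auto
    finally show ?thesis
      by (simp add: h.emeasure_eq_measure)
  qed
  have "AE t in lborel. \<forall>c\<in>C. \<forall>\<epsilon>>0. \<exists>\<delta>>0. \<forall>a b. a \<le> t \<longrightarrow> t \<le> b \<longrightarrow> b - a < \<delta> \<longrightarrow>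
      measure (density lborel (h c)) {a<..b} \<le> (h c t + \<epsilon>) * (b - a)"
    by (intro AE_ball_countable'[OF _ C(1)] AE_upper_density_le[OF h_int h0])
  moreover have "AE t in lborel. t \<in> {0..T} \<longrightarrow> g t \<in> closure C"
    using C(2) unfolding M_def by (subst (asm) AE_density) (auto elim!: eventually_mono split: split_indicator_asm)
  ultimately show ?thesis
  proof eventually_elim
    case (elim t)
    show ?case
    proof (intro impI exI[of _ "g t"])
      assume t: "0 < t" "t < T"
      show "(u has_vector_derivative g t) (at t)"
        unfolding has_vector_derivative_def has_derivative_at_alt
      proof (intro conjI allI impI)
        show "bounded_linear (\<lambda>x. x *\<^sub>R g t)"
          by (rule bounded_linear_scaleR_left)
        fix e :: real assume "0 < e"
        have "g t \<in> closure C"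
          using elim(2) t by auto
        then obtain c where c: "c \<in> C" "dist c (g t) < e / 3"
          using \<open>0 < e\<close> by (auto simp: closure_approachable dest: spec[of _ "e / 3"])
        obtain \<delta> where \<delta>: "0 < \<delta>" "\<And>a b. a \<le> t \<Longrightarrow> t \<le> b \<Longrightarrow> b - a < \<delta> \<Longrightarrow>
            measure (density lborel (h c)) {a<..b} \<le> (h c t + e / 3) * (b - a)"
          using elim(1)[rule_format, OF c(1), of "e / 3"] \<open>0 < e\<close> by auto
        have ht: "h c t < e / 3"
          using c(2) t by (simp add: h_def dist_norm norm_minus_commute)
        have est: "norm (u b - u a - (b - a) *\<^sub>R g t) \<le> e * (b - a)"
          if ab: "0 \<le> a" "a \<le> t" "t \<le> b" "b \<le> T" "b - a < \<delta>" for a b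
        proof -
          have "norm (u b - u a - (b - a) *\<^sub>R g t)
              \<le> norm (u b - u a - (b - a) *\<^sub>R c) + norm ((b - a) *\<^sub>R c - (b - a) *\<^sub>R g t)"
            using norm_triangle_ineq[of "u b - u a - (b - a) *\<^sub>R c" "(b - a) *\<^sub>R c - (b - a) *\<^sub>R g t"] by simp
          also have "norm (u b - u a - (b - a) *\<^sub>R c) \<le> (h c t + e / 3) * (b - a)"
            using incr[of a b c] \<delta>(2)[of a b] ab by linarith
          also have "\<dots> \<le> (e / 3 + e / 3) * (b - a)"
            using ht ab by (intro mult_right_mono) auto
          also have "norm ((b - a) *\<^sub>R c - (b - a) *\<^sub>R g t) \<le> (b - a) * (e / 3)"
            unfolding scaleR_diff_right[symmetric] norm_scaleR
            using c(2) ab by (intro mult_mono) (auto simp: dist_norm)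
          also have "(e / 3 + e / 3) * (b - a) + (b - a) * (e / 3) = e * (b - a)"
            by (simp add: field_simps)
          finally show ?thesis
            by simp
        qed
        show "\<exists>d>0. \<forall>y. norm (y - t) < d \<longrightarrow> norm (u y - u t - (y - t) *\<^sub>R g t) \<le> e * norm (y - t)"
        proof (intro exI[of _ "min \<delta> (min t (T - t))"] conjI allI impI)
          fix y assume y: "norm (y - t) < min \<delta> (min t (T - t))"
          show "norm (u y - u t - (y - t) *\<^sub>R g t) \<le> e * norm (y - t)"
          proof (cases "t \<le> y")
            case True
            then show ?thesis using est[of t y] y t by auto
          next
            case False
            then have "norm (u t - u y - (t - y) *\<^sub>R g t) \<le> e * (t - y)"
              using est[of y t] y t by auto
            moreover have "u t - u y - (t - y) *\<^sub>R g t = - (u y - u t - (y - t) *\<^sub>R g t)"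
              by (simp add: algebra_simps)
            ultimately show ?thesis
              using False by (metis abs_minus_commute abs_of_pos diff_gt_0_iff_gt norm_minus_cancel not_le real_norm_def)
          qed
        qed (use t \<delta> in auto)
      qed
    qed
  qed
qed

lemma radon_nikodym_AE_differentiable:
  fixes u :: "real \<Rightarrow> 'v::real_normed_vector \<Rightarrow>\<^sub>L real"
  assumes "radon_nikodym_property TYPE('v \<Rightarrow>\<^sub>L real)" "locally_abs_cont u"
  shows "AE t in lborel. 0 < t \<longrightarrow> (\<exists>d. (u has_vector_derivative d) (at t))"
proof -
  have "AE t in lborel. \<forall>n::nat. 0 < t \<longrightarrow> t < real n \<longrightarrow> (\<exists>d. (u has_vector_derivative d) (at t))"
    by (subst AE_all_countable) (auto intro!: radon_nikodym_AE_differentiable_on assms)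
  then show ?thesis
    by eventually_elim (meson reals_Archimedean2)
qed

subsection \<open>Bregman divergences and Frechet subgradients\<close>

lemma grad_has_derivative:
  assumes "f differentiable (at z)"
  shows "(f has_derivative blinfun_apply (grad f z)) (at z)"
proof -
  have d: "(f has_derivative frechet_derivative f (at z)) (at z)"
    using assms by (simp add: frechet_derivative_works)
  then show ?thesis
    unfolding grad_def by (simp add: bounded_linear_Blinfun_apply has_derivative_bounded_linear)
qed

lemma bregman_diff:
  "bregman f y z' - bregman f y z = blinfun_apply (grad f z - grad f z') (y - z) + bregman f z z'"
  by (simp add: bregman_def blinfun.diff_left blinfun.diff_right)

text \<open>For nonnegative divergences this symmetrised form bounds each summand by a product of
  increments of the gradient and of the point.\<close>

lemma bregman_add_swap:
  "bregman f z w + bregman f w z = blinfun_apply (grad f z - grad f w) (z - w)"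
  by (simp add: bregman_def blinfun.diff_left blinfun.diff_right)

text \<open>Relative convexity makes the local subgradient condition global. Along the segment from
  \<open>z\<close> to \<open>y\<close> it bounds \<open>\<Phi>\<close> from above by an affine part
  plus \<open>lam * \<Psi>\<close>, whose difference quotient at \<open>z\<close> converges to the
  directional derivative. Since this is a limit and not an inequality, the sign of
  \<open>lam\<close> is immaterial.\<close>

lemma frechet_subdiff_convex_forD:
  assumes conv: "convex_for lam \<Psi> \<Phi>" and diff: "\<Psi> differentiable (at z)"
    and \<zeta>: "\<zeta> \<in> frechet_subdiff \<Phi> z" and z: "\<Phi> z = ereal a" and y: "\<Phi> y = ereal b"
    and ninf: "\<And>v. \<Phi> v \<noteq> -\<infinity>"
  shows "blinfun_apply \<zeta> (y - z) + lam * bregman \<Psi> y z \<le> b - a"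
proof (cases "y = z")
  case True
  then show ?thesis using z y by (simp add: bregman_def)
next
  case False
  define v where "v = y - z"
  define w where "w t = z + t *\<^sub>R v" for t :: real
  have "0 < norm v"
    using False by (simp add: v_def)
  have lim_w: "filterlim w (at z) (at_right 0)"
    unfolding filterlim_at
  proof
    have "((\<lambda>t. z + t *\<^sub>R v) \<longlongrightarrow> z + 0 *\<^sub>R v) (at_right 0)"
      by (intro tendsto_intros)
    then show "(w \<longlongrightarrow> z) (at_right 0)"
      by (simp add: w_def[abs_def])
    show "\<forall>\<^sub>F t in at_right 0. w t \<in> UNIV \<and> w t \<noteq> z"
      using \<open>0 < norm v\<close> by (auto simp: w_def intro!: eventually_at_rightI[of 0 1])
  qed
  \<comment> \<open>This is the upper bound that convexity gives for
    \<open>(\<Phi> (w t) - \<Phi> z) / t - blinfun_apply \<zeta> v\<close>.\<close>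
  define q where "q t = lam * ((\<Psi> (w t) - \<Psi> z) / t) + (b - a) - lam * (\<Psi> y - \<Psi> z) - blinfun_apply \<zeta> v" for t
  have lim_q: "(q \<longlongrightarrow> lam * blinfun_apply (grad \<Psi> z) v + (b - a) - lam * (\<Psi> y - \<Psi> z) - blinfun_apply \<zeta> v) (at_right 0)"
  proof -
    have "((\<lambda>t. \<Psi> (w t)) has_derivative (\<lambda>t. blinfun_apply (grad \<Psi> z) (t *\<^sub>R v))) (at 0)"
    proof (rule has_derivative_compose[of w "\<lambda>t. t *\<^sub>R v"])
      show "(w has_derivative (\<lambda>t. t *\<^sub>R v)) (at 0)"
        unfolding w_def[abs_def] by (auto intro!: derivative_eq_intros)
      show "(\<Psi> has_derivative blinfun_apply (grad \<Psi> z)) (at (w 0))"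
        using grad_has_derivative[OF diff] by (simp add: w_def)
    qed
    then have "((\<lambda>t. \<Psi> (w t)) has_real_derivative blinfun_apply (grad \<Psi> z) v) (at 0)"
      by (simp add: has_field_derivative_def blinfun.scaleR_right mult_commute_abs)
    then have "((\<lambda>t. (\<Psi> (w t) - \<Psi> z) / t) \<longlongrightarrow> blinfun_apply (grad \<Psi> z) v) (at 0)"
      by (simp add: has_field_derivative_iff w_def)
    then have "((\<lambda>t. (\<Psi> (w t) - \<Psi> z) / t) \<longlongrightarrow> blinfun_apply (grad \<Psi> z) v) (at_right 0)"
      by (simp add: filterlim_at_split)
    then show ?thesis
      unfolding q_def by (intro tendsto_intros)
  qed
  have "- \<epsilon> \<le> lam * blinfun_apply (grad \<Psi> z) v + (b - a) - lam * (\<Psi> y - \<Psi> z) - blinfun_apply \<zeta> v"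
    if "0 < \<epsilon>" for \<epsilon>
  proof (rule tendsto_lowerbound[OF lim_q])
    have "\<forall>\<^sub>F u in at z. ereal (- \<epsilon> / norm v) < (\<Phi> u - \<Phi> z - ereal (blinfun_apply \<zeta> (u - z))) / ereal (norm (u - z))"
      using \<zeta> \<open>0 < \<epsilon>\<close> \<open>0 < norm v\<close> unfolding frechet_subdiff_def by (auto simp: le_Liminf_iff)
    then have ev: "\<forall>\<^sub>F t in at_right 0. ereal (- \<epsilon> / norm v) <
        (\<Phi> (w t) - \<Phi> z - ereal (blinfun_apply \<zeta> (w t - z))) / ereal (norm (w t - z))"
      by (rule eventually_compose_filterlim[OF _ lim_w])
    have ev1: "\<forall>\<^sub>F t in at_right 0. 0 < t \<and> t < (1::real)"
      by (auto intro!: eventually_at_rightI[of 0 1])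
    from ev ev1 show "\<forall>\<^sub>F t in at_right 0. - \<epsilon> \<le> q t"
    proof eventually_elim
      case (elim t)
      have wt: "w t = (1 - t) *\<^sub>R z + t *\<^sub>R y"
        by (simp add: w_def v_def algebra_simps)
      have cv: "\<Phi> (w t) - ereal (lam * \<Psi> (w t)) \<le>
          ereal (1 - t) * (\<Phi> z - ereal (lam * \<Psi> z)) + ereal t * (\<Phi> y - ereal (lam * \<Psi> y))"
        using conv elim unfolding convex_for_def convex_ereal_def wt by blast
      then obtain c where c: "\<Phi> (w t) = ereal c"
        using ninf[of "w t"] z y by (cases "\<Phi> (w t)") auto
      have "c - lam * \<Psi> (w t) \<le> (1 - t) * (a - lam * \<Psi> z) + t * (b - lam * \<Psi> y)"
        using cv unfolding c z y by simp
      moreover have "- \<epsilon> / norm v < (c - a - t * blinfun_apply \<zeta> v) / (t * norm v)"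
        using elim \<open>0 < norm v\<close> unfolding c z by (simp add: w_def blinfun.scaleR_right)
      then have "- \<epsilon> * t < c - a - t * blinfun_apply \<zeta> v"
        using elim \<open>0 < norm v\<close> by (simp add: field_simps)
      ultimately have "- \<epsilon> * t \<le> lam * (\<Psi> (w t) - \<Psi> z) + t * (b - a) - t * (lam * (\<Psi> y - \<Psi> z)) - t * blinfun_apply \<zeta> v"
        by (simp add: algebra_simps)
      also have "\<dots> = q t * t"
        using elim by (simp add: q_def field_simps)
      finally show ?case
        using elim by (intro mult_right_le_imp_le[of "- \<epsilon>" t "q t"]) auto
    qed
  qed simp
  note eps = this
  have "0 \<le> lam * blinfun_apply (grad \<Psi> z) v + (b - a) - lam * (\<Psi> y - \<Psi> z) - blinfun_apply \<zeta> v"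
  proof (rule field_le_epsilon)
    fix \<epsilon> :: real assume "0 < \<epsilon>"
    from eps[OF this] show "0 \<le> lam * blinfun_apply (grad \<Psi> z) v + (b - a) - lam * (\<Psi> y - \<Psi> z) - blinfun_apply \<zeta> v + \<epsilon>"
      by linarith
  qed
  then show ?thesis
    by (simp add: bregman_def v_def algebra_simps)
qed

text \<open>The divergence is the first-order Taylor remainder of \<open>\<Psi>\<close> at
  \<open>z\<close>, hence \<open>o(norm (y - z))\<close>, and disappears in the lower limit for
  either sign of \<open>lam\<close>.\<close>

lemma frechet_subdiff_bregmanI:
  assumes diff: "\<Psi> differentiable (at z)" and z: "\<Phi> z = ereal a"
    and ninf: "\<And>v. \<Phi> v \<noteq> -\<infinity>"
    and le: "\<And>y b. \<Phi> y = ereal b \<Longrightarrow> blinfun_apply \<zeta> (y - z) + lam * bregman \<Psi> y z \<le> b - a"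
  shows "\<zeta> \<in> frechet_subdiff \<Phi> z"
  unfolding frechet_subdiff_def
proof (intro CollectI conjI)
  show "z \<in> eff_dom \<Phi>"
    using z by (simp add: eff_dom_def)
  show "0 \<le> Liminf (at z) (\<lambda>y. (\<Phi> y - \<Phi> z - ereal (blinfun_apply \<zeta> (y - z))) / ereal (norm (y - z)))"
    unfolding le_Liminf_iff
  proof (intro allI impI)
    fix c :: ereal assume "c < 0"
    obtain \<epsilon> :: real where \<epsilon>: "0 < \<epsilon>" "c \<le> ereal (- \<epsilon>)"
    proof (cases c)
      case (real r)
      then show ?thesis using \<open>c < 0\<close> by (intro that[of "- r"]) auto
    next
      case MInf
      then show ?thesis by (intro that[of 1]) auto
    qed (use \<open>c < 0\<close> in auto)
    \<comment> \<open>The denominator is positive even for \<open>lam = 0\<close>; the half makes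
      \<open>\<bar>lam\<bar> * \<eta> < \<epsilon>\<close> strict.\<close>
    define \<eta> where "\<eta> = (\<epsilon> / 2) / (\<bar>lam\<bar> + 1)"
    have lam1: "\<bar>lam\<bar> + 1 \<noteq> 0"
      by (metis abs_add_one_gt_zero add.commute less_irrefl)
    have "0 < \<eta>"
      using \<epsilon> by (simp add: \<eta>_def)
    have \<eta>: "\<bar>lam\<bar> * \<eta> < \<epsilon>"
    proof -
      have "\<bar>lam\<bar> * \<eta> \<le> (\<bar>lam\<bar> + 1) * \<eta>"
        using \<open>0 < \<eta>\<close> by (intro mult_right_mono) auto
      also have "\<dots> = \<epsilon> / 2"
        unfolding \<eta>_def using lam1 by (rule nonzero_mult_div_cancel_left[of "\<bar>lam\<bar> + 1" "\<epsilon> / 2", unfolded times_divide_eq_right[symmetric]])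
      finally show ?thesis using \<epsilon> by simp
    qed
    obtain d where d: "0 < d" "\<And>y. norm (y - z) < d \<Longrightarrow> \<bar>bregman \<Psi> y z\<bar> \<le> \<eta> * norm (y - z)"
      using grad_has_derivative[OF diff] \<open>0 < \<eta>\<close>
      unfolding has_derivative_at_alt bregman_def real_norm_def by blast
    have "c < (\<Phi> y - \<Phi> z - ereal (blinfun_apply \<zeta> (y - z))) / ereal (norm (y - z))"
      if y: "y \<noteq> z" "dist y z < d" for y
    proof (cases "\<Phi> y")
      case (real b)
      have n: "0 < norm (y - z)"
        using y by simp
      have "\<bar>lam * bregman \<Psi> y z\<bar> \<le> \<bar>lam\<bar> * (\<eta> * norm (y - z))"
        unfolding abs_mult using d(2)[of y] y by (intro mult_left_mono) (auto simp: dist_norm)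
      also have "\<dots> < \<epsilon> * norm (y - z)"
        using \<eta> n by (simp flip: mult.assoc)
      finally have "- \<epsilon> * norm (y - z) < b - a - blinfun_apply \<zeta> (y - z)"
        using le[OF real] by (simp add: abs_less_iff)
      then have "- \<epsilon> < (b - a - blinfun_apply \<zeta> (y - z)) / norm (y - z)"
        using n by (simp add: field_simps)
      then show ?thesis
        using \<epsilon>(2) n real z by (auto intro: le_less_trans)
    next
      case PInf
      then show ?thesis
        using y z \<open>c < 0\<close> by auto
    qed (use ninf in auto)
    then show "\<forall>\<^sub>F y in at z. c < (\<Phi> y - \<Phi> z - ereal (blinfun_apply \<zeta> (y - z))) / ereal (norm (y - z))"
      unfolding eventually_at using d(1) by auto
  qed
qed

text \<open>\<open>lsc\<close> speaks of punctured neighbourhoods only. Since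
  \<open>c < \<Phi> z\<close> also holds at \<open>z\<close> itself, \<open>f\<close> is allowed to
  take the value \<open>z\<close>.\<close>

lemma lsc_eventually_less:
  assumes "lsc \<Phi>" "(f \<longlongrightarrow> z) F" "c < \<Phi> z"
  shows "\<forall>\<^sub>F r in F. c < \<Phi> (f r)"
proof -
  have "\<forall>\<^sub>F y in at z. c < \<Phi> y"
    using assms(1,3) unfolding lsc_def le_Liminf_iff by blast
  then have "\<forall>\<^sub>F y in nhds z. c < \<Phi> y"
    using assms(3) by (auto simp: eventually_at_filter elim!: eventually_mono)
  then show ?thesis
    by (rule eventually_compose_filterlim[OF _ assms(2)])
qed

text \<open>For negative \<open>t\<close> this continues the antiderivative of
  \<open>exp (lam * r)\<close>, whereas \<open>E_fun\<close> integrates over an empty interval and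
  is 0. It is thus differentiable on the whole line, including at 0.\<close>

definition exp_int :: "real \<Rightarrow> real \<Rightarrow> real" where
  "exp_int lam t = (if lam = 0 then t else (exp (lam * t) - 1) / lam)"

lemma exp_int_0 [simp]: "exp_int lam 0 = 0"
  by (simp add: exp_int_def)

lemma has_real_derivative_exp_int: "(exp_int lam has_real_derivative exp (lam * t)) (at t)"
  by (cases "lam = 0") (auto simp: exp_int_def[abs_def] intro!: derivative_eq_intros)

lemma E_fun_eq_exp_int:
  assumes "0 \<le> t"
  shows "E_fun lam t = exp_int lam t"
proof -
  have "((\<lambda>r. exp (lam * r)) has_integral exp_int lam t - exp_int lam 0) {0..t}"
    using assms by (intro fundamental_theorem_of_calculus)
      (auto intro: has_field_derivative_at_within has_real_derivative_exp_int
        simp flip: has_real_derivative_iff_has_vector_derivative)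
  then show ?thesis
    unfolding E_fun_def by (simp add: integral_unique)
qed

lemma exp_int_pos: "0 < t \<Longrightarrow> 0 < exp_int lam t"
  by (cases lam "0::real" rule: linorder_cases) (auto simp: exp_int_def zero_less_divide_iff mult_neg_pos)

subsection \<open>Bregman divergences along curves\<close>

text \<open>The increment bound that \<open>nonincreasing_if_AE_deriv_nonpos\<close> consumes.
  Fixing \<open>\<nu>\<close> makes the class closed under differences and products, as the weighted
  divergences require.\<close>

definition lipschitz_wrt :: "real measure \<Rightarrow> real \<Rightarrow> (real \<Rightarrow> real) \<Rightarrow> bool" where
  "lipschitz_wrt \<nu> T u \<longleftrightarrow>
     (\<exists>K\<ge>0. \<forall>p q. 0 \<le> p \<longrightarrow> p \<le> q \<longrightarrow> q \<le> T \<longrightarrow> \<bar>u q - u p\<bar> \<le> K * measure \<nu> {p<..q})"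

lemma lipschitz_wrtE:
  assumes "lipschitz_wrt \<nu> T u"
  obtains K where "0 \<le> K" "\<And>p q. 0 \<le> p \<Longrightarrow> p \<le> q \<Longrightarrow> q \<le> T \<Longrightarrow> \<bar>u q - u p\<bar> \<le> K * measure \<nu> {p<..q}"
  using assms unfolding lipschitz_wrt_def by blast

lemma lipschitz_wrt_diff:
  assumes "lipschitz_wrt \<nu> T u" "lipschitz_wrt \<nu> T v"
  shows "lipschitz_wrt \<nu> T (\<lambda>r. u r - v r)"
proof -
  obtain K where K: "0 \<le> K" "\<And>p q. 0 \<le> p \<Longrightarrow> p \<le> q \<Longrightarrow> q \<le> T \<Longrightarrow> \<bar>u q - u p\<bar> \<le> K * measure \<nu> {p<..q}"
    using assms(1) by (rule lipschitz_wrtE) blast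
  obtain L where L: "0 \<le> L" "\<And>p q. 0 \<le> p \<Longrightarrow> p \<le> q \<Longrightarrow> q \<le> T \<Longrightarrow> \<bar>v q - v p\<bar> \<le> L * measure \<nu> {p<..q}"
    using assms(2) by (rule lipschitz_wrtE) blast
  have "\<bar>u q - v q - (u p - v p)\<bar> \<le> (K + L) * measure \<nu> {p<..q}" if "0 \<le> p" "p \<le> q" "q \<le> T" for p q
    using K(2)[OF that] L(2)[OF that] by (simp add: distrib_right)
  then show ?thesis
    unfolding lipschitz_wrt_def using K(1) L(1) by (intro exI[of _ "K + L"]) auto
qed

lemma lipschitz_wrt_mult:
  assumes "finite_measure \<nu>" "sets \<nu> = sets borel" "lipschitz_wrt \<nu> T u" "lipschitz_wrt \<nu> T v"
  shows "lipschitz_wrt \<nu> T (\<lambda>r. u r * v r)"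
proof -
  interpret finite_measure \<nu> by fact
  obtain K where K: "0 \<le> K" "\<And>p q. 0 \<le> p \<Longrightarrow> p \<le> q \<Longrightarrow> q \<le> T \<Longrightarrow> \<bar>u q - u p\<bar> \<le> K * measure \<nu> {p<..q}"
    using assms(3) by (rule lipschitz_wrtE) blast
  obtain L where L: "0 \<le> L" "\<And>p q. 0 \<le> p \<Longrightarrow> p \<le> q \<Longrightarrow> q \<le> T \<Longrightarrow> \<bar>v q - v p\<bar> \<le> L * measure \<nu> {p<..q}"
    using assms(4) by (rule lipschitz_wrtE) blast
  have le: "measure \<nu> {p<..q} \<le> measure \<nu> UNIV" for p q :: real
    using assms(2) by (intro finite_measure_mono) auto
  \<comment> \<open>Increments from time 0 are bounded by the total mass, so both factors are
    bounded on \<open>{0..T}\<close> and the product rule applies.\<close>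
  define U where "U = \<bar>u 0\<bar> + K * measure \<nu> UNIV"
  define V where "V = \<bar>v 0\<bar> + L * measure \<nu> UNIV"
  have U: "\<bar>u r\<bar> \<le> U" if "0 \<le> r" "r \<le> T" for r
    using K(2)[of 0 r] mult_left_mono[OF le[of 0 r] K(1)] that unfolding U_def by linarith
  have V: "\<bar>v r\<bar> \<le> V" if "0 \<le> r" "r \<le> T" for r
    using L(2)[of 0 r] mult_left_mono[OF le[of 0 r] L(1)] that unfolding V_def by linarith
  have "0 \<le> U" "0 \<le> V"
    using K(1) L(1) by (simp_all add: U_def V_def)
  have "\<bar>u q * v q - u p * v p\<bar> \<le> (U * L + V * K) * measure \<nu> {p<..q}" if "0 \<le> p" "p \<le> q" "q \<le> T" for p q
  proof -
    have "u q * v q - u p * v p = u q * (v q - v p) + v p * (u q - u p)"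
      by (simp add: algebra_simps)
    also have "\<bar>\<dots>\<bar> \<le> \<bar>u q\<bar> * \<bar>v q - v p\<bar> + \<bar>v p\<bar> * \<bar>u q - u p\<bar>"
      using abs_triangle_ineq by (simp add: abs_mult[symmetric])
    also have "\<dots> \<le> U * (L * measure \<nu> {p<..q}) + V * (K * measure \<nu> {p<..q})"
      using that \<open>0 \<le> U\<close> \<open>0 \<le> V\<close> by (intro add_mono mult_mono U V K L) auto
    finally show ?thesis
      by (simp add: algebra_simps)
  qed
  then show ?thesis
    unfolding lipschitz_wrt_def using \<open>0 \<le> U\<close> \<open>0 \<le> V\<close> K(1) L(1)
    by (intro exI[of _ "U * L + V * K"]) auto
qed

lemma lipschitz_wrt_C1:
  assumes le: "\<And>p q. 0 \<le> p \<Longrightarrow> p \<le> q \<Longrightarrow> q \<le> T \<Longrightarrow> q - p \<le> measure \<nu> {p<..q}"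
    and deriv: "\<And>r. (u has_real_derivative u' r) (at r)" and cont: "continuous_on {0..T} u'"
  shows "lipschitz_wrt \<nu> T u"
proof -
  have "bounded (u' ` {0..T})"
    by (intro compact_imp_bounded compact_continuous_image cont) simp
  then obtain K where K: "0 < K" "\<And>r. r \<in> {0..T} \<Longrightarrow> \<bar>u' r\<bar> \<le> K"
    unfolding bounded_pos by auto
  have "\<bar>u q - u p\<bar> \<le> K * measure \<nu> {p<..q}" if "0 \<le> p" "p \<le> q" "q \<le> T" for p q
  proof -
    have "norm (u q - u p) \<le> K * norm (q - p)"
    proof (rule field_differentiable_bound[of "{0..T}" u u'])
      show "(u has_real_derivative u' z) (at z within {0..T})" for z
        by (rule has_field_derivative_at_within[OF deriv])
    qed (use that K in auto)
    also have "\<dots> \<le> K * measure \<nu> {p<..q}"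
      using le[OF that] that K(1) by (intro mult_left_mono) auto
    finally show ?thesis by simp
  qed
  then show ?thesis
    unfolding lipschitz_wrt_def using K(1) by (intro exI[of _ K]) auto
qed

locale coercive_potential =
  fixes \<Psi> :: "'v::real_normed_vector \<Rightarrow> real" and \<alpha> C :: real
  assumes diff: "\<And>z. \<Psi> differentiable (at z)"
    and \<alpha>: "1 < \<alpha>" and C: "0 < C"
    and coercive: "\<And>u v. norm (v - u) powr \<alpha> \<le> C * bregman \<Psi> v u"
begin

lemma bregman_nonneg: "0 \<le> bregman \<Psi> v u"
proof -
  have "0 \<le> C * bregman \<Psi> v u"
    using coercive[of v u] by (rule order_trans[rotated]) simp
  then show ?thesis
    using C by (simp add: zero_le_mult_iff)
qed

lemma bregman_le: "bregman \<Psi> z w \<le> norm (grad \<Psi> z - grad \<Psi> w) * norm (z - w)"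
proof -
  have "bregman \<Psi> z w \<le> bregman \<Psi> z w + bregman \<Psi> w z"
    using bregman_nonneg by simp
  also have "\<dots> = blinfun_apply (grad \<Psi> z - grad \<Psi> w) (z - w)"
    by (rule bregman_add_swap)
  also have "\<dots> \<le> norm (grad \<Psi> z - grad \<Psi> w) * norm (z - w)"
    using norm_blinfun[of "grad \<Psi> z - grad \<Psi> w" "z - w"] by simp
  finally show ?thesis .
qed

text \<open>Coercivity and \<open>bregman_le\<close> bound \<open>norm (z - w) powr \<alpha>\<close>
  by a multiple of the gradient increment times \<open>norm (z - w)\<close>; one factor cancels. The
  point is thus a Hoelder function of its gradient, which carries continuity and boundedness from
  \<open>grad \<Psi> (x t)\<close> to \<open>x t\<close>.\<close>

lemma norm_diff_le_grad:
  "norm (z - w) \<le> (C * norm (grad \<Psi> z - grad \<Psi> w)) powr (1 / (\<alpha> - 1))"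
proof (cases "z = w")
  case False
  define n where "n = norm (z - w)"
  have "0 < n"
    using False by (simp add: n_def)
  have "n powr (\<alpha> - 1) * n = n powr \<alpha>"
    using \<open>0 < n\<close> powr_add[of n "\<alpha> - 1" 1] by simp
  also have "\<dots> \<le> C * (norm (grad \<Psi> z - grad \<Psi> w) * n)"
    using order_trans[OF coercive[of z w] mult_left_mono[OF bregman_le[of z w], of C]] C by (simp add: n_def)
  finally have "n powr (\<alpha> - 1) \<le> C * norm (grad \<Psi> z - grad \<Psi> w)"
    using \<open>0 < n\<close> by (simp flip: mult.assoc)
  then have "(n powr (\<alpha> - 1)) powr (1 / (\<alpha> - 1)) \<le> (C * norm (grad \<Psi> z - grad \<Psi> w)) powr (1 / (\<alpha> - 1))"
    using \<alpha> by (intro powr_mono2) auto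
  then show ?thesis
    using \<alpha> \<open>0 < n\<close> by (simp add: powr_powr n_def)
qed simp

lemma tendsto_if_grad_tendsto:
  assumes "((\<lambda>r. grad \<Psi> (x r)) \<longlongrightarrow> grad \<Psi> z) F"
  shows "(x \<longlongrightarrow> z) F"
proof -
  have "((\<lambda>r. norm (grad \<Psi> (x r) - grad \<Psi> z)) \<longlongrightarrow> 0) F"
    using assms by (simp add: LIM_zero tendsto_norm_zero)
  then have "((\<lambda>r. C * norm (grad \<Psi> (x r) - grad \<Psi> z)) \<longlongrightarrow> 0) F"
    by (rule tendsto_mult_right_zero)
  then have "((\<lambda>r. (C * norm (grad \<Psi> (x r) - grad \<Psi> z)) powr (1 / (\<alpha> - 1))) \<longlongrightarrow> 0) F"
    by (rule tendsto_zero_powrI[OF _ tendsto_const]) (use \<alpha> C in auto)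
  then have "((\<lambda>r. x r - z) \<longlongrightarrow> 0) F"
    by (rule Lim_null_comparison[rotated]) (simp add: norm_diff_le_grad)
  then show ?thesis
    by (simp add: LIM_zero_iff)
qed

text \<open>The curve \<open>x\<close> itself need not be differentiable. The remainder
  \<open>bregman \<Psi> (x t) (x r)\<close> is at most a gradient increment, of order
  \<open>\<bar>r - t\<bar>\<close>, times \<open>norm (x t - x r)\<close>, which tends to 0.\<close>

lemma bregman_curve_has_derivative:
  assumes d: "((\<lambda>r. grad \<Psi> (x r)) has_vector_derivative d) (at t)"
  shows "((\<lambda>r. bregman \<Psi> y (x r)) has_real_derivative - blinfun_apply d (y - x t)) (at t)"
proof -
  have xlim: "(x \<longlongrightarrow> x t) (at t)"
    using has_vector_derivative_continuous[OF d] by (intro tendsto_if_grad_tendsto) (simp add: isCont_def)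
  obtain e where e: "0 < e"
    "\<And>r. norm (r - t) < e \<Longrightarrow> norm (grad \<Psi> (x r) - grad \<Psi> (x t) - (r - t) *\<^sub>R d) \<le> 1 * norm (r - t)"
    using d unfolding has_vector_derivative_def has_derivative_at_alt by (meson zero_less_one)
  have "((\<lambda>r. bregman \<Psi> (x t) (x r)) has_real_derivative 0) (at t)"
    unfolding has_field_derivative_iff
  proof (rule Lim_null_comparison)
    show "((\<lambda>r. (1 + norm d) * norm (x t - x r)) \<longlongrightarrow> 0) (at t)"
      using tendsto_diff[OF tendsto_const xlim, of "x t"]
      by (intro tendsto_mult_right_zero tendsto_norm_zero) simp
    show "\<forall>\<^sub>F r in at t. norm ((bregman \<Psi> (x t) (x r) - bregman \<Psi> (x t) (x t)) / (r - t))
        \<le> (1 + norm d) * norm (x t - x r)"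
      unfolding eventually_at
    proof (intro exI[of _ e] conjI ballI impI e(1))
      fix r assume r: "r \<noteq> t \<and> dist r t < e"
      have "norm (grad \<Psi> (x r) - grad \<Psi> (x t)) \<le>
          norm (grad \<Psi> (x r) - grad \<Psi> (x t) - (r - t) *\<^sub>R d) + norm ((r - t) *\<^sub>R d)"
        by (rule norm_triangle_sub[of _ "(r - t) *\<^sub>R d", unfolded add.commute[of "norm ((r - t) *\<^sub>R d)"]])
      also have "\<dots> \<le> (1 + norm d) * \<bar>r - t\<bar>"
        using e(2)[of r] r by (simp add: dist_norm distrib_left distrib_right mult.commute)
      finally have "norm (grad \<Psi> (x t) - grad \<Psi> (x r)) \<le> (1 + norm d) * \<bar>r - t\<bar>"
        by (simp add: norm_minus_commute)
      then have "bregman \<Psi> (x t) (x r) \<le> (1 + norm d) * \<bar>r - t\<bar> * norm (x t - x r)"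
        by (intro order_trans[OF bregman_le] mult_right_mono) auto
      then show "norm ((bregman \<Psi> (x t) (x r) - bregman \<Psi> (x t) (x t)) / (r - t))
          \<le> (1 + norm d) * norm (x t - x r)"
        using r bregman_nonneg[of "x t" "x r"] by (simp add: bregman_def[of _ "x t" "x t"] divide_le_eq ac_simps)
    qed
  qed
  moreover have "((\<lambda>r. blinfun_apply (grad \<Psi> (x r)) (y - x t)) has_real_derivative blinfun_apply d (y - x t)) (at t)"
    using bounded_linear.has_vector_derivative[OF blinfun.bounded_linear_left d]
    by (simp add: has_real_derivative_iff_has_vector_derivative)
  ultimately have "((\<lambda>r. bregman \<Psi> y (x t) + (blinfun_apply (grad \<Psi> (x t)) (y - x t)
      - blinfun_apply (grad \<Psi> (x r)) (y - x t)) + bregman \<Psi> (x t) (x r))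
      has_real_derivative 0 + (0 - blinfun_apply d (y - x t)) + 0) (at t)"
    by (intro DERIV_add DERIV_diff DERIV_const)
  moreover have "bregman \<Psi> y (x t) + (blinfun_apply (grad \<Psi> (x t)) (y - x t)
      - blinfun_apply (grad \<Psi> (x r)) (y - x t)) + bregman \<Psi> (x t) (x r) = bregman \<Psi> y (x r)" for r
    using bregman_diff[of \<Psi> y "x r" "x t"] by (simp add: blinfun.diff_left)
  ultimately show ?thesis
    by simp
qed

lemma lipschitz_wrt_bregman_curve:
  assumes "finite_measure \<nu>" "sets \<nu> = sets borel"
    and \<xi>: "\<And>p q. 0 \<le> p \<Longrightarrow> p \<le> q \<Longrightarrow> q \<le> T \<Longrightarrow> norm (grad \<Psi> (x q) - grad \<Psi> (x p)) \<le> measure \<nu> {p<..q}"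
  shows "lipschitz_wrt \<nu> T (\<lambda>r. bregman \<Psi> y (x r))"
proof -
  interpret finite_measure \<nu> by fact
  define R where "R = (C * measure \<nu> UNIV) powr (1 / (\<alpha> - 1))"
  have R: "norm (x q - x p) \<le> R" if "0 \<le> p" "p \<le> q" "q \<le> T" for p q
  proof -
    have "norm (grad \<Psi> (x q) - grad \<Psi> (x p)) \<le> measure \<nu> {p<..q}"
      using that by (rule \<xi>)
    also have "\<dots> \<le> measure \<nu> UNIV"
      using assms(2) by (intro finite_measure_mono) auto
    finally have "(C * norm (grad \<Psi> (x q) - grad \<Psi> (x p))) powr (1 / (\<alpha> - 1)) \<le> R"
      unfolding R_def using C \<alpha> by (intro powr_mono2 mult_left_mono) auto
    then show ?thesis
      using norm_diff_le_grad[of "x q" "x p"] by simp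
  qed
  \<comment> \<open>One \<open>R\<close> covers the way from \<open>x 0\<close> to
    \<open>x p\<close>, the other that from \<open>x p\<close> to \<open>x q\<close>.\<close>
  define B where "B = norm (y - x 0) + 2 * R"
  have "0 \<le> R"
    by (simp add: R_def)
  have "\<bar>bregman \<Psi> y (x q) - bregman \<Psi> y (x p)\<bar> \<le> B * measure \<nu> {p<..q}" if pq: "0 \<le> p" "p \<le> q" "q \<le> T" for p q
  proof -
    define \<delta> where "\<delta> = norm (grad \<Psi> (x p) - grad \<Psi> (x q))"
    have "\<bar>bregman \<Psi> y (x q) - bregman \<Psi> y (x p)\<bar>
        \<le> \<bar>blinfun_apply (grad \<Psi> (x p) - grad \<Psi> (x q)) (y - x p)\<bar> + \<bar>bregman \<Psi> (x p) (x q)\<bar>"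
      unfolding bregman_diff by (rule abs_triangle_ineq)
    also have "\<dots> \<le> \<delta> * norm (y - x p) + \<delta> * norm (x p - x q)"
      using norm_blinfun[of "grad \<Psi> (x p) - grad \<Psi> (x q)" "y - x p"] bregman_le[of "x p" "x q"]
        bregman_nonneg[of "x p" "x q"] by (simp add: \<delta>_def)
    also have "\<dots> = (norm (y - x p) + norm (x p - x q)) * \<delta>"
      by (simp add: algebra_simps)
    also have "\<dots> \<le> B * measure \<nu> {p<..q}"
    proof (rule mult_mono)
      have "norm (y - x p) \<le> norm (y - x 0) + norm (x p - x 0)"
        using norm_triangle_ineq4[of "y - x 0" "x p - x 0"] by simp
      then show "norm (y - x p) + norm (x p - x q) \<le> B"
        using R[of 0 p] R[of p q] pq unfolding B_def by (simp add: norm_minus_commute)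
      show "\<delta> \<le> measure \<nu> {p<..q}"
        using \<xi>[OF pq] by (simp add: \<delta>_def norm_minus_commute)
    qed (use \<open>0 \<le> R\<close> in \<open>auto simp: B_def \<delta>_def\<close>)
    finally show ?thesis .
  qed
  then show ?thesis
    unfolding lipschitz_wrt_def using \<open>0 \<le> R\<close> by (intro exI[of _ B]) (auto simp: B_def)
qed

end

subsection \<open>Mirror flows and evolution variational inequalities\<close>

locale mirror_flow_potential = coercive_potential \<Psi> \<alpha> C
  for \<Psi> :: "'v::real_normed_vector \<Rightarrow> real" and \<alpha> C +
  fixes \<Phi> :: "'v \<Rightarrow> ereal" and lam :: real
  assumes not_MInf: "\<And>v. \<Phi> v \<noteq> -\<infinity>" and lsc: "lsc \<Phi>" and conv: "convex_for lam \<Psi> \<Phi>"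
begin

text \<open>The differential form of the EVI, holding off a null set that does not depend on the test point \<open>y\<close>.\<close>

lemma mirror_flow_differential_EVI:
  assumes flow: "mirror_flow \<Psi> \<Phi> x"
  obtains \<nu> N where "finite_measure \<nu>" "sets \<nu> = sets borel" "N \<in> null_sets \<nu>"
    "continuous_on {0..T} x"
    "\<And>y. lipschitz_wrt \<nu> T (\<lambda>r. bregman \<Psi> y (x r))"
    "\<And>p q. 0 \<le> p \<Longrightarrow> p \<le> q \<Longrightarrow> q \<le> T \<Longrightarrow> q - p \<le> measure \<nu> {p<..q}"
    "\<And>t. 0 \<le> t \<Longrightarrow> t \<notin> N \<Longrightarrow> x t \<in> eff_dom \<Phi>"
    "\<And>t y b. 0 \<le> t \<Longrightarrow> t \<notin> N \<Longrightarrow> \<Phi> y = ereal b \<Longrightarrow>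
      \<exists>D c. \<Phi> (x t) = ereal c \<and> D + lam * bregman \<Psi> y (x t) \<le> b - c \<and>
        ((\<lambda>r. bregman \<Psi> y (x r)) has_real_derivative D) (at t)"
proof -
  have ac: "locally_abs_cont (\<lambda>t. grad \<Psi> (x t))"
    and ae: "AE t in lebesgue. 0 < t \<longrightarrow> (\<exists>\<zeta>\<in>frechet_subdiff \<Phi> (x t).
           ((\<lambda>r. grad \<Psi> (x r)) has_vector_derivative - \<zeta>) (at t))"
    using flow unfolding mirror_flow_def by blast+
  obtain \<nu> where \<nu>: "finite_measure \<nu>" "sets \<nu> = sets borel"
    "null_sets (density lborel (indicator {0..T::real})) \<subseteq> null_sets \<nu>"
    and \<xi>: "\<And>s t. 0 \<le> s \<Longrightarrow> s \<le> t \<Longrightarrow> t \<le> T \<Longrightarrow> norm (grad \<Psi> (x t) - grad \<Psi> (x s)) \<le> measure \<nu> {s<..t}"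
    and le: "\<And>s t. 0 \<le> s \<Longrightarrow> s \<le> t \<Longrightarrow> t \<le> T \<Longrightarrow> t - s \<le> measure \<nu> {s<..t}"
    by (rule locally_abs_cont_dominating_measure[OF ac, of T]) blast
  interpret finite_borel_measure \<nu>
    using \<nu> by (simp add: finite_borel_measure_def finite_borel_measure_axioms_def)
  have null: "N \<in> null_sets \<nu>" if "N \<in> null_sets lborel" for N
    using that \<nu>(3) absolutely_continuousI_density[of "indicator {0..T}" lborel]
    by (auto simp: absolutely_continuous_def)
  obtain N0 where N0: "N0 \<in> null_sets lborel" and "{t. \<not> (0 < t \<longrightarrow> (\<exists>\<zeta>\<in>frechet_subdiff \<Phi> (x t).
           ((\<lambda>r. grad \<Psi> (x r)) has_vector_derivative - \<zeta>) (at t)))} \<subseteq> N0"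
  proof -
    obtain N1 where "N1 \<in> null_sets lebesgue" "{t. \<not> (0 < t \<longrightarrow> (\<exists>\<zeta>\<in>frechet_subdiff \<Phi> (x t).
           ((\<lambda>r. grad \<Psi> (x r)) has_vector_derivative - \<zeta>) (at t)))} \<subseteq> N1"
      using ae unfolding eventually_ae_filter by auto
    then show thesis
      using that unfolding null_sets_completion_iff2 by blast
  qed
  then have N0': "\<exists>\<zeta>\<in>frechet_subdiff \<Phi> (x t). ((\<lambda>r. grad \<Psi> (x r)) has_vector_derivative - \<zeta>) (at t)"
    if "0 < t" "t \<notin> N0" for t
    using that by blast
  show thesis
  \<comment> \<open>The flow condition concerns \<open>t > 0\<close> only; adding the null point 0
    lets the conclusions range over \<open>0 \<le> t\<close>.\<close>
  proof (rule that[of \<nu> "insert 0 N0"])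
    show "finite_measure \<nu>" "sets \<nu> = sets borel" by fact+
    show "insert 0 N0 \<in> null_sets \<nu>"
      using null_sets.Un[of "{0}" lborel N0] N0 by (intro null) (simp add: null_setsI)
    show "lipschitz_wrt \<nu> T (\<lambda>r. bregman \<Psi> y (x r))" for y
      by (rule lipschitz_wrt_bregman_curve[OF \<nu>(1,2) \<xi>])
    show "q - p \<le> measure \<nu> {p<..q}" if "0 \<le> p" "p \<le> q" "q \<le> T" for p q
      using that by (rule le)
    show "x t \<in> eff_dom \<Phi>" if "0 \<le> t" "t \<notin> insert 0 N0" for t
      using N0'[of t] that by (auto simp: frechet_subdiff_def)
    show "\<exists>D c. \<Phi> (x t) = ereal c \<and> D + lam * bregman \<Psi> y (x t) \<le> b - c \<and>
        ((\<lambda>r. bregman \<Psi> y (x r)) has_real_derivative D) (at t)"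
      if t: "0 \<le> t" "t \<notin> insert 0 N0" and y: "\<Phi> y = ereal b" for t y b
    proof -
      obtain \<zeta> where \<zeta>: "\<zeta> \<in> frechet_subdiff \<Phi> (x t)" "((\<lambda>r. grad \<Psi> (x r)) has_vector_derivative - \<zeta>) (at t)"
        using N0'[of t] t by auto
      obtain c where c: "\<Phi> (x t) = ereal c"
        using \<zeta>(1) not_MInf[of "x t"] by (cases "\<Phi> (x t)") (auto simp: frechet_subdiff_def eff_dom_def)
      have "((\<lambda>r. bregman \<Psi> y (x r)) has_real_derivative blinfun_apply \<zeta> (y - x t)) (at t)"
        using bregman_curve_has_derivative[OF \<zeta>(2), of y] by (simp add: blinfun.minus_left)
      with c frechet_subdiff_convex_forD[OF conv diff \<zeta>(1) c y not_MInf] show ?thesis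
        by blast
    qed
    show "continuous_on {0..T} x"
      unfolding continuous_on_def
    proof
      fix t assume t: "t \<in> {0..T}"
      \<comment> \<open>Singletons are Lebesgue null, so \<open>\<nu>\<close> has no atoms.\<close>
      have "isCont (cdf \<nu>) t"
        unfolding isCont_cdf using null[of "{t}"] by (auto simp: measure_def null_sets_def)
      then have "(cdf \<nu> \<longlongrightarrow> cdf \<nu> t) (at t within {0..T})"
        by (auto simp: isCont_def intro: tendsto_mono[OF at_le])
      then have "((\<lambda>r. \<bar>cdf \<nu> r - cdf \<nu> t\<bar>) \<longlongrightarrow> 0) (at t within {0..T})"
        by (intro tendsto_rabs_zero LIM_zero)
      then have "((\<lambda>r. grad \<Psi> (x r) - grad \<Psi> (x t)) \<longlongrightarrow> 0) (at t within {0..T})"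
      proof (rule Lim_null_comparison[rotated])
        have "norm (grad \<Psi> (x r) - grad \<Psi> (x t)) \<le> \<bar>cdf \<nu> r - cdf \<nu> t\<bar>" if "r \<in> {0..T}" for r
          using \<xi>[of t r] \<xi>[of r t] cdf_diff_eq[of t r] cdf_diff_eq[of r t] t that
          by (cases r t rule: linorder_cases) (auto simp: norm_minus_commute)
        then show "\<forall>\<^sub>F r in at t within {0..T}. norm (grad \<Psi> (x r) - grad \<Psi> (x t)) \<le> \<bar>cdf \<nu> r - cdf \<nu> t\<bar>"
          by (auto simp: eventually_at_filter)
      qed
      then show "(x \<longlongrightarrow> x t) (at t within {0..T})"
        by (intro tendsto_if_grad_tendsto) (simp add: LIM_zero_iff)
    qed
  qed
qed

text \<open>Gronwall's argument: with the weight \<open>exp (lam * (r - s))\<close>, the derivative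
  of \<open>u\<close> is that weight times
  \<open>D + lam * bregman \<Psi> y (x r) - \<kappa>\<close>, hence nonpositive. The bound
  \<open>\<kappa>\<close> is constant so that nothing about the regularity of
  \<open>\<Phi> (x r)\<close> in \<open>r\<close> enters.\<close>

lemma exp_bregman_le:
  assumes "finite_measure \<nu>" "sets \<nu> = sets borel" "N \<in> null_sets \<nu>"
    and lip: "lipschitz_wrt \<nu> T (\<lambda>r. bregman \<Psi> y (x r))"
    and le: "\<And>p q. 0 \<le> p \<Longrightarrow> p \<le> q \<Longrightarrow> q \<le> T \<Longrightarrow> q - p \<le> measure \<nu> {p<..q}"
    and st: "0 \<le> s" "s \<le> t" "t \<le> T"
    and deriv: "\<And>r. s \<le> r \<Longrightarrow> r \<le> t \<Longrightarrow> r \<notin> N \<Longrightarrow>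
      \<exists>D. D + lam * bregman \<Psi> y (x r) \<le> \<kappa> \<and> ((\<lambda>r. bregman \<Psi> y (x r)) has_real_derivative D) (at r)"
  shows "exp (lam * (t - s)) * bregman \<Psi> y (x t) - bregman \<Psi> y (x s) \<le> exp_int lam (t - s) * \<kappa>"
proof -
  define u where "u r = exp (lam * (r - s)) * bregman \<Psi> y (x r) - exp_int lam (r - s) * \<kappa>" for r
  have du: "((\<lambda>r. exp (lam * (r - s))) has_real_derivative lam * exp (lam * (r - s))) (at r)" for r
    by (auto intro!: derivative_eq_intros)
  have de: "((\<lambda>r. exp_int lam (r - s) * \<kappa>) has_real_derivative exp (lam * (r - s)) * \<kappa>) (at r)" for r
    using DERIV_cmult_right[OF DERIV_chain2[OF has_real_derivative_exp_int DERIV_diff[OF DERIV_ident DERIV_const]], where c = \<kappa>]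
    by simp
  have "lipschitz_wrt \<nu> T u"
    unfolding u_def[abs_def]
  proof (rule lipschitz_wrt_diff[OF lipschitz_wrt_mult[OF assms(1,2) _ lip]])
    show "lipschitz_wrt \<nu> T (\<lambda>r. exp (lam * (r - s)))"
      by (rule lipschitz_wrt_C1[OF le du]) (auto intro!: continuous_intros)
    show "lipschitz_wrt \<nu> T (\<lambda>r. exp_int lam (r - s) * \<kappa>)"
      by (rule lipschitz_wrt_C1[OF le de]) (auto intro!: continuous_intros)
  qed
  then obtain K where K: "0 \<le> K" "\<And>p q. 0 \<le> p \<Longrightarrow> p \<le> q \<Longrightarrow> q \<le> T \<Longrightarrow> \<bar>u q - u p\<bar> \<le> K * measure \<nu> {p<..q}"
    by (rule lipschitz_wrtE) blast
  have "u t \<le> u s"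
  proof (rule nonincreasing_if_AE_deriv_nonpos[OF assms(1-3) st(2) K(1)])
    show "\<bar>u q - u p\<bar> \<le> K * measure \<nu> {p<..q}" if "s \<le> p" "p \<le> q" "q \<le> t" for p q
      using that st by (intro K) auto
    fix r assume "r \<in> {s..t}" "r \<notin> N"
    then obtain D where D: "D + lam * bregman \<Psi> y (x r) \<le> \<kappa>"
        "((\<lambda>r. bregman \<Psi> y (x r)) has_real_derivative D) (at r)"
      using deriv[of r] by auto
    have "(u has_real_derivative lam * exp (lam * (r - s)) * bregman \<Psi> y (x r) + D * exp (lam * (r - s))
        - exp (lam * (r - s)) * \<kappa>) (at r)"
      unfolding u_def[abs_def] by (intro DERIV_diff DERIV_mult du D de)
    moreover have "lam * exp (lam * (r - s)) * bregman \<Psi> y (x r) + D * exp (lam * (r - s)) - exp (lam * (r - s)) * \<kappa>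
        = exp (lam * (r - s)) * (D + lam * bregman \<Psi> y (x r) - \<kappa>)"
      by (simp add: algebra_simps)
    moreover have "\<dots> \<le> 0"
      using D(1) by (intro mult_nonneg_nonpos) auto
    ultimately show "\<exists>D\<le>0. (u has_real_derivative D) (at r)"
      by metis
  qed
  then show ?thesis
    by (simp add: u_def)
qed

text \<open>
  If \<open>\<Phi>\<close> exceeded \<open>\<Phi> (x s)\<close> at a later time, then, starting from the last time \<open>a\<close> at which it does not, the
  divergence from \<open>x a\<close> would decrease strictly from its minimum \<open>0\<close>.
\<close>

lemma mirror_flow_nonincreasing:
  assumes flow: "mirror_flow \<Psi> \<Phi> x" and st: "0 \<le> s" "s \<le> t"
  shows "\<Phi> (x t) \<le> \<Phi> (x s)"
proof (rule ccontr)
  assume "\<not> \<Phi> (x t) \<le> \<Phi> (x s)"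
  then have less: "\<Phi> (x s) < \<Phi> (x t)"
    by simp
  obtain \<nu> N where \<nu>: "finite_measure \<nu>" "sets \<nu> = sets borel" "N \<in> null_sets \<nu>"
    and cont: "continuous_on {0..t} x"
    and lip: "\<And>y. lipschitz_wrt \<nu> t (\<lambda>r. bregman \<Psi> y (x r))"
    and le: "\<And>p q. 0 \<le> p \<Longrightarrow> p \<le> q \<Longrightarrow> q \<le> t \<Longrightarrow> q - p \<le> measure \<nu> {p<..q}"
    and deriv: "\<And>t y b. 0 \<le> t \<Longrightarrow> t \<notin> N \<Longrightarrow> \<Phi> y = ereal b \<Longrightarrow>
      \<exists>D c. \<Phi> (x t) = ereal c \<and> D + lam * bregman \<Psi> y (x t) \<le> b - c \<and>
        ((\<lambda>r. bregman \<Psi> y (x r)) has_real_derivative D) (at t)"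
    by (rule mirror_flow_differential_EVI[OF flow, of t]) blast
  interpret finite_measure \<nu> by fact
  define S where "S = {r \<in> {s..t}. \<Phi> (x r) \<le> \<Phi> (x s)}"
  define a where "a = Sup S"
  have "s \<in> S"
    using st by (simp add: S_def)
  have bdd: "bdd_above S"
    by (rule bdd_aboveI[of _ t]) (simp add: S_def)
  have "s \<le> a"
    unfolding a_def by (rule cSup_upper[OF \<open>s \<in> S\<close> bdd])
  moreover have "a \<le> t"
    unfolding a_def by (rule cSup_least) (use \<open>s \<in> S\<close> in \<open>auto simp: S_def\<close>)
  ultimately have a: "s \<le> a" "a \<le> t"
    by simp_all
  \<comment> \<open>Lower semicontinuity along the continuous curve makes \<open>S\<close> closed,
    so its supremum is attained.\<close>
  have "a \<in> S"
  proof (rule ccontr)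
    assume "a \<notin> S"
    then have "\<Phi> (x s) < \<Phi> (x a)"
      using a by (simp add: S_def)
    moreover have "(x \<longlongrightarrow> x a) (at a within {0..t})"
      using cont a st by (auto simp: continuous_on_def)
    ultimately have "\<forall>\<^sub>F r in at a within {0..t}. \<Phi> (x s) < \<Phi> (x r)"
      by (intro lsc_eventually_less[OF lsc])
    then obtain d where d: "0 < d" "\<And>r. r \<in> {0..t} \<Longrightarrow> r \<noteq> a \<Longrightarrow> dist r a < d \<Longrightarrow> \<Phi> (x s) < \<Phi> (x r)"
      unfolding eventually_at by blast
    obtain r where r: "r \<in> S" "a - d < r"
      using less_cSupD[of S "a - d"] \<open>s \<in> S\<close> \<open>0 < d\<close> by (auto simp: a_def)
    then have "r \<le> a"
      using cSup_upper[OF r(1) bdd] by (simp add: a_def)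
    with r \<open>a \<notin> S\<close> d(2)[of r] st show False
      by (cases "r = a") (auto simp: S_def dist_real_def)
  qed
  then have "a \<noteq> t" "\<Phi> (x a) \<le> \<Phi> (x s)"
    using less by (auto simp: S_def)
  with a have "a < t" by simp
  have above: "\<Phi> (x a) < \<Phi> (x r)" if "a < r" "r \<le> t" for r
  proof -
    have "r \<notin> S"
      using cSup_upper[OF _ bdd, of r] that by (auto simp: a_def)
    then show ?thesis
      using that a \<open>\<Phi> (x a) \<le> \<Phi> (x s)\<close> by (auto simp: S_def)
  qed
  obtain b where b: "\<Phi> (x a) = ereal b"
    using above[of t] \<open>a < t\<close> not_MInf[of "x a"] by (cases "\<Phi> (x a)") auto
  \<comment> \<open>On \<open>{a..t}\<close> the values of \<open>\<Phi>\<close> are at least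
    \<open>\<Phi> (x a)\<close>, so the inequality with test point \<open>x a\<close> holds with
    \<open>\<kappa> = 0\<close>, and the divergence starts from 0 at time \<open>a\<close>.\<close>
  have zero: "bregman \<Psi> (x a) (x r) = 0" if "a \<le> r" "r \<le> t" for r
  proof -
    have "exp (lam * (r - a)) * bregman \<Psi> (x a) (x r) - bregman \<Psi> (x a) (x a) \<le> exp_int lam (r - a) * 0"
    proof (rule exp_bregman_le[OF \<nu> lip le])
      fix p assume p: "a \<le> p" "p \<le> r" "p \<notin> N"
      then obtain D c where D: "\<Phi> (x p) = ereal c" "D + lam * bregman \<Psi> (x a) (x p) \<le> b - c"
          "((\<lambda>r. bregman \<Psi> (x a) (x r)) has_real_derivative D) (at p)"
        using deriv[of p "x a" b] b a st by auto
      have "b \<le> c"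
        using above[of p] p that D(1) b by (cases "p = a") auto
      with D show "\<exists>D. D + lam * bregman \<Psi> (x a) (x p) \<le> 0 \<and>
          ((\<lambda>r. bregman \<Psi> (x a) (x r)) has_real_derivative D) (at p)"
        by (intro exI[of _ D]) auto
    qed (use that a st in auto)
    then have "exp (lam * (r - a)) * bregman \<Psi> (x a) (x r) \<le> 0"
      by (simp add: bregman_def[of _ "x a" "x a"])
    then show ?thesis
      using bregman_nonneg[of "x a" "x r"] by (simp add: mult_le_0_iff)
  qed
  have "\<not> {a<..t} \<subseteq> N"
  proof
    assume "{a<..t} \<subseteq> N"
    then have "measure \<nu> {a<..t} \<le> measure \<nu> N"
      using \<nu> by (intro finite_measure_mono) auto
    also have "\<dots> = 0"
      using \<nu>(3) by (simp add: measure_eq_0_null_sets)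
    finally show False
      using le[of a t] a st \<open>a < t\<close> by simp
  qed
  then obtain r where r: "a < r" "r \<le> t" "r \<notin> N"
    unfolding subset_iff greaterThanAtMost_iff by blast
  obtain D c where D: "\<Phi> (x r) = ereal c" "D + lam * bregman \<Psi> (x a) (x r) \<le> b - c"
      "((\<lambda>r. bregman \<Psi> (x a) (x r)) has_real_derivative D) (at r)"
    using deriv[of r "x a" b] b a st r by auto
  \<comment> \<open>The value 0 is a global minimum of the divergence, so its derivative vanishes
    even if \<open>r = t\<close>, beyond which \<open>zero\<close> gives no information.\<close>
  have "D = 0"
    using bregman_nonneg zero[of r] r by (intro DERIV_local_min[OF D(3), of 1]) auto
  then show False
    using D above[of r] r b zero[of r] by auto
qed

text \<open>The definition of a flow gives finiteness only at almost every time; monotonicity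
  carries it from an earlier good time to \<open>t\<close>. There is no earlier time for
  \<open>t = 0\<close>.\<close>

lemma mirror_flow_eff_dom:
  assumes flow: "mirror_flow \<Psi> \<Phi> x" and "0 < t"
  shows "x t \<in> eff_dom \<Phi>"
proof -
  obtain \<nu> N where \<nu>: "finite_measure \<nu>" "sets \<nu> = sets borel" "N \<in> null_sets \<nu>"
    and le: "\<And>p q. 0 \<le> p \<Longrightarrow> p \<le> q \<Longrightarrow> q \<le> t \<Longrightarrow> q - p \<le> measure \<nu> {p<..q}"
    and dom: "\<And>t. 0 \<le> t \<Longrightarrow> t \<notin> N \<Longrightarrow> x t \<in> eff_dom \<Phi>"
    by (rule mirror_flow_differential_EVI[OF flow, of t]) blast
  interpret finite_measure \<nu> by fact
  have "\<not> {0<..t} \<subseteq> N"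
  proof
    assume "{0<..t} \<subseteq> N"
    then have "measure \<nu> {0<..t} \<le> measure \<nu> N"
      using \<nu> by (intro finite_measure_mono) auto
    also have "\<dots> = 0"
      using \<nu>(3) by (simp add: measure_eq_0_null_sets)
    finally show False
      using le[of 0 t] \<open>0 < t\<close> by simp
  qed
  then obtain r where r: "0 < r" "r \<le> t" "r \<notin> N"
    unfolding subset_iff greaterThanAtMost_iff by blast
  have "\<Phi> (x t) \<le> \<Phi> (x r)"
    using r by (intro mirror_flow_nonincreasing[OF flow]) auto
  also have "\<Phi> (x r) < \<infinity>"
    using dom[of r] r by (simp add: eff_dom_def)
  finally show ?thesis
    by (simp add: eff_dom_def)
qed

text \<open>By monotonicity \<open>\<Phi> (x r) \<ge> \<Phi> (x t)\<close> for
  \<open>r \<le> t\<close>, so the constant \<open>\<Phi> y - \<Phi> (x t)\<close> is an admissible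
  \<open>\<kappa>\<close> on all of \<open>{s..t}\<close>.\<close>

lemma mirror_flow_imp_EVI_solution:
  assumes flow: "mirror_flow \<Psi> \<Phi> x"
  shows "EVI_solution lam (bregman \<Psi>) \<Phi> x"
  unfolding EVI_solution_def
proof (intro allI impI ballI)
  fix s t :: real and y assume st: "0 \<le> s" "s \<le> t" and "y \<in> eff_dom \<Phi>"
  then obtain b where b: "\<Phi> y = ereal b"
    using not_MInf[of y] by (cases "\<Phi> y") (auto simp: eff_dom_def)
  show "ereal (exp (lam * (t - s)) * bregman \<Psi> y (x t) - bregman \<Psi> y (x s))
      \<le> ereal (E_fun lam (t - s)) * (\<Phi> y - \<Phi> (x t))"
  \<comment> \<open>An infinite \<open>\<Phi> (x t)\<close> can occur only in the first case, at
    time 0; \<open>s < t\<close> forces \<open>0 < t\<close>.\<close>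
  proof (cases "s = t")
    case True
    then show ?thesis
      by (simp add: E_fun_eq_exp_int flip: zero_ereal_def)
  next
    case False
    obtain c where c: "\<Phi> (x t) = ereal c"
      using mirror_flow_eff_dom[OF flow, of t] False st not_MInf[of "x t"]
      by (cases "\<Phi> (x t)") (auto simp: eff_dom_def)
    obtain \<nu> N where \<nu>: "finite_measure \<nu>" "sets \<nu> = sets borel" "N \<in> null_sets \<nu>"
      and lip: "\<And>y. lipschitz_wrt \<nu> t (\<lambda>r. bregman \<Psi> y (x r))"
      and le: "\<And>p q. 0 \<le> p \<Longrightarrow> p \<le> q \<Longrightarrow> q \<le> t \<Longrightarrow> q - p \<le> measure \<nu> {p<..q}"
      and deriv: "\<And>t y b. 0 \<le> t \<Longrightarrow> t \<notin> N \<Longrightarrow> \<Phi> y = ereal b \<Longrightarrow>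
        \<exists>D c. \<Phi> (x t) = ereal c \<and> D + lam * bregman \<Psi> y (x t) \<le> b - c \<and>
          ((\<lambda>r. bregman \<Psi> y (x r)) has_real_derivative D) (at t)"
      by (rule mirror_flow_differential_EVI[OF flow, of t]) blast
    have "exp (lam * (t - s)) * bregman \<Psi> y (x t) - bregman \<Psi> y (x s) \<le> exp_int lam (t - s) * (b - c)"
    proof (rule exp_bregman_le[OF \<nu> lip le])
      fix r assume r: "s \<le> r" "r \<le> t" "r \<notin> N"
      then obtain D c' where D: "\<Phi> (x r) = ereal c'" "D + lam * bregman \<Psi> y (x r) \<le> b - c'"
          "((\<lambda>r. bregman \<Psi> y (x r)) has_real_derivative D) (at r)"
        using deriv[of r y b] b st by auto
      have "c \<le> c'"
        using mirror_flow_nonincreasing[OF flow, of r t] r st c D(1) by simp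
      with D show "\<exists>D. D + lam * bregman \<Psi> y (x r) \<le> b - c \<and>
          ((\<lambda>r. bregman \<Psi> y (x r)) has_real_derivative D) (at r)"
        by (intro exI[of _ D]) auto
    qed (use st in auto)
    then show ?thesis
      using st by (simp add: b c E_fun_eq_exp_int)
  qed
qed

text \<open>The EVI started at \<open>t\<close> is divided by \<open>r - t\<close> and
  \<open>r\<close> decreases to \<open>t\<close>. It evaluates \<open>\<Phi>\<close> at the later
  time \<open>r\<close>, so a lower bound on \<open>\<Phi> (x r)\<close> suffices, which lower
  semicontinuity supplies. The limit is the global inequality that
  \<open>frechet_subdiff_bregmanI\<close> asks for.\<close>

lemma EVI_solution_derivative_in_frechet_subdiff:
  assumes EVI: "EVI_solution lam (bregman \<Psi>) \<Phi> x" and proper: "eff_dom \<Phi> \<noteq> {}" and "0 < t"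
    and d: "((\<lambda>r. grad \<Psi> (x r)) has_vector_derivative d) (at t)"
  shows "- d \<in> frechet_subdiff \<Phi> (x t)"
proof -
  have EVI': "ereal (exp (lam * (q - p)) * bregman \<Psi> y (x q) - bregman \<Psi> y (x p))
      \<le> ereal (exp_int lam (q - p)) * (\<Phi> y - \<Phi> (x q))" if "0 \<le> p" "p \<le> q" "y \<in> eff_dom \<Phi>" for p q y
    using EVI that unfolding EVI_solution_def by (metis E_fun_eq_exp_int diff_ge_0_iff_ge)
  \<comment> \<open>An infinite \<open>\<Phi> (x r)\<close> would make the right-hand side of the
    EVI on \<open>{0..r}\<close> equal to \<open>-\<infinity>\<close>, while the left-hand side is
    real.\<close>
  have fin: "\<exists>c. \<Phi> (x r) = ereal c" if "0 < r" for r
  proof -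
    obtain y where y: "y \<in> eff_dom \<Phi>"
      using proper by auto
    obtain b where b: "\<Phi> y = ereal b"
      using y not_MInf[of y] by (cases "\<Phi> y") (auto simp: eff_dom_def)
    have "\<Phi> (x r) \<noteq> \<infinity>"
      using EVI'[of 0 r y] y b that exp_int_pos[of r lam] by auto
    then show ?thesis
      using not_MInf[of "x r"] by (cases "\<Phi> (x r)") auto
  qed
  obtain a where a: "\<Phi> (x t) = ereal a"
    using fin[OF \<open>0 < t\<close>] by auto
  have xlim: "(x \<longlongrightarrow> x t) (at_right t)"
    using has_vector_derivative_continuous[OF d]
    by (intro tendsto_if_grad_tendsto) (simp add: isCont_def filterlim_at_split)
  show ?thesis
  proof (rule frechet_subdiff_bregmanI[where \<Psi> = \<Psi> and \<Phi> = \<Phi>, OF diff a not_MInf])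
    fix y b assume b: "\<Phi> y = ereal b"
    then have y: "y \<in> eff_dom \<Phi>"
      by (simp add: eff_dom_def)
    define v where "v r = exp (lam * (r - t)) * bregman \<Psi> y (x r)" for r
    define L where "L = lam * bregman \<Psi> y (x t) - blinfun_apply d (y - x t)"
    have "(v has_real_derivative lam * exp (lam * (t - t)) * bregman \<Psi> y (x t)
        + - blinfun_apply d (y - x t) * exp (lam * (t - t))) (at t)"
      unfolding v_def[abs_def]
      by (intro DERIV_mult bregman_curve_has_derivative[OF d]) (auto intro!: derivative_eq_intros)
    then have v: "((\<lambda>r. (v r - v t) / (r - t)) \<longlongrightarrow> L) (at_right t)"
      by (simp add: has_field_derivative_iff L_def filterlim_at_split)
    have "((\<lambda>r. exp_int lam (r - t)) has_real_derivative exp (lam * (t - t)) * (1 - 0)) (at t)"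
      by (intro DERIV_chain2[OF has_real_derivative_exp_int] DERIV_diff DERIV_ident DERIV_const)
    then have e: "((\<lambda>r. exp_int lam (r - t) / (r - t)) \<longlongrightarrow> 1) (at_right t)"
      by (simp add: has_field_derivative_iff filterlim_at_split)
    have "L \<le> b - a"
    proof (rule field_le_epsilon)
      fix \<epsilon> :: real assume "0 < \<epsilon>"
      have "\<forall>\<^sub>F r in at_right t. ereal (a - \<epsilon>) < \<Phi> (x r)"
        by (rule lsc_eventually_less[OF lsc xlim]) (use \<open>0 < \<epsilon>\<close> a in simp)
      moreover have "\<forall>\<^sub>F r in at_right t. t < r"
        by (auto intro!: eventually_at_rightI[of t "t + 1"])
      ultimately have "\<forall>\<^sub>F r in at_right t. (v r - v t) / (r - t) \<le> exp_int lam (r - t) / (r - t) * (b - a + \<epsilon>)"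
      proof eventually_elim
        case (elim r)
        obtain c where c: "\<Phi> (x r) = ereal c"
          using fin[of r] elim \<open>0 < t\<close> by auto
        have "v r - v t \<le> exp_int lam (r - t) * (b - c)"
          using EVI'[of t r y] y elim \<open>0 < t\<close> by (simp add: v_def b c)
        also have "\<dots> \<le> exp_int lam (r - t) * (b - a + \<epsilon>)"
          using elim c exp_int_pos[of "r - t" lam] by (intro mult_left_mono) auto
        finally show ?case
          using elim by (simp add: divide_right_mono)
      qed
      moreover have "((\<lambda>r. exp_int lam (r - t) / (r - t) * (b - a + \<epsilon>)) \<longlongrightarrow> 1 * (b - a + \<epsilon>)) (at_right t)"
        by (intro tendsto_intros e)
      ultimately have "L \<le> 1 * (b - a + \<epsilon>)"
        by (intro tendsto_le[OF _ _ v]) auto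
      then show "L \<le> b - a + \<epsilon>" by simp
    qed
    then show "blinfun_apply (- d) (y - x t) + lam * bregman \<Psi> y (x t) \<le> b - a"
      by (simp add: L_def blinfun.minus_left)
  qed
qed

end

theorem theorem3p9:
  fixes \<Psi> :: "'v::banach \<Rightarrow> real"
    and \<Phi> :: "'v \<Rightarrow> ereal"
    and lam :: real
    and x :: "real \<Rightarrow> 'v"
  assumes RNP: "radon_nikodym_property TYPE('v \<Rightarrow>\<^sub>L real)"
    and Psi_nonneg: "\<And>v. 0 \<le> \<Psi> v"
    and Psi_convex: "convex_on UNIV \<Psi>"
    and Psi_C1: "C1_functional \<Psi>"
    and conj_finite: "\<And>\<phi>. fenchel_conj \<Psi> \<phi> < \<infinity>"
    and conj_C1: "C1_functional (conjugate_real \<Psi>)"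
    and Phi_not_MInf: "\<And>v. \<Phi> v \<noteq> -\<infinity>"
    and Phi_proper: "eff_dom \<Phi> \<noteq> {}"
    and Phi_lsc: "lsc \<Phi>"
    and Phi_convex: "convex_for lam \<Psi> \<Phi>"
    and coercive: "\<exists>\<alpha> C. \<alpha> > 1 \<and> C > 0 \<and>
      (\<forall>u v. norm (v - u) powr \<alpha> \<le> C * bregman \<Psi> v u)"
    and dual_bound: "\<exists>g :: real \<Rightarrow> real.
      continuous_on {0<..} g \<and> (\<forall>r>0. g r > 0) \<and> filterlim g at_top (at_right 0) \<and>
      dual_lower_bound g (bregman (conjugate_real \<Psi>))"
  shows "(mirror_flow \<Psi> \<Phi> x \<longleftrightarrow>
            EVI_solution lam (bregman \<Psi>) \<Phi> x \<and> locally_abs_cont (\<lambda>t. grad \<Psi> (x t))) \<and>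
         (mirror_flow \<Psi> \<Phi> x \<longrightarrow> antimono_on {0..} (\<lambda>t. \<Phi> (x t)))"
proof -
  obtain \<alpha> C where "\<alpha> > 1" "C > 0" "\<And>u v. norm (v - u) powr \<alpha> \<le> C * bregman \<Psi> v u"
    using coercive by blast
  then interpret mirror_flow_potential \<Psi> \<alpha> C \<Phi> lam
    using Psi_C1 Phi_not_MInf Phi_lsc Phi_convex by unfold_locales (auto simp: C1_functional_def)
  have "mirror_flow \<Psi> \<Phi> x" if "EVI_solution lam (bregman \<Psi>) \<Phi> x" "locally_abs_cont (\<lambda>t. grad \<Psi> (x t))"
    unfolding mirror_flow_def
  proof
    have "AE t in lebesgue. 0 < t \<longrightarrow> (\<exists>d. ((\<lambda>r. grad \<Psi> (x r)) has_vector_derivative d) (at t))"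
      by (intro AE_completion radon_nikodym_AE_differentiable RNP that)
    then show "AE t in lebesgue. 0 < t \<longrightarrow> (\<exists>\<xi>\<in>frechet_subdiff \<Phi> (x t).
        ((\<lambda>r. grad \<Psi> (x r)) has_vector_derivative - \<xi>) (at t))"
    proof eventually_elim
      case (elim t)
      then show ?case
        using EVI_solution_derivative_in_frechet_subdiff[OF that(1) Phi_proper] by (metis minus_minus)
    qed
  qed (fact that)
  moreover have "locally_abs_cont (\<lambda>t. grad \<Psi> (x t))" if "mirror_flow \<Psi> \<Phi> x"
    using that by (simp add: mirror_flow_def)
  moreover have "antimono_on {0..} (\<lambda>t. \<Phi> (x t))" if "mirror_flow \<Psi> \<Phi> x"
    by (intro monotone_onI mirror_flow_nonincreasing[OF that]) auto
  ultimately show ?thesis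
    using mirror_flow_imp_EVI_solution by blast
qed

end
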